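(* Let $n\ge 1$, $\delta\in(0,n)$, $\alpha\in(0,\delta)$ and $p\in(1,\delta/\alpha)$. Then there exists a constant $c$, depending only on $n$, $\delta$, $\alpha$ and $p$, such that for all Lebesgue measurable functions $f:\mathbb{R}^n\to[-\infty,\infty]$ $$\bigg(\int_{\mathbb{R}^n}\big(\mathcal{R}^\delta_\alpha f(x)\big)^{\frac{\delta p}{\delta-p\alpha}}\,d\mathcal{H}^{\delta}_\infty\bigg)^{\frac{\delta-p\alpha}{\delta p}}\le c\,\bigg(\int_{\mathbb{R}^n}|f(x)|^p\,d\mathcal{H}^\delta_\infty\bigg)^{\frac1p}.$$
   Context: For $\delta\in(0,n]$ and any set $E\subset\mathbb{R}^n$, the $\delta$-dimensional Hausdorff content is $\mathcal{H}^\delta_\infty(E):=\inf\{\sum_{i} r_i^\delta : E\subset\bigcup_{i} B(x_i,r_i)\}$, the infimum being over all countable (or finite) collections of open balls covering $E$. For an arbitrary set $\Omega\subset\mathbb{R}^n$ and an arbitrary function $g:\Omega\to[0,\infty]$ (no measurability required), the integral with respect to $\mathcal{H}^\delta_\infty$ is the Choquet integral $\int_\Omega g\,d\mathcal{H}^\delta_\infty:=\int_0^\infty \mathcal{H}^\delta_\infty(\{x\in\Omega: g(x)>t\})\,dt$. The Hausdorff content Riesz potential of $f:\mathbb{R}^n\to[-\infty,\infty]$ is, for $\delta\in(0,n]$ and $\alpha\in(0,\delta)$, $$\mathcal{R}^\delta_\alpha f(x):=\int_{\mathbb{R}^n}\frac{|f(y)|}{|x-y|^{\delta-\alpha}}\,d\mathcal{H}^\delta_\infty(y),\qquad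 x\in\mathbb{R}^n.$$ *)

theory Defs
  imports "HOL-Analysis.Analysis"
begin

text \<open>Powers on \<open>[0,\<infinity>]\<close>; only used for exponents \<open>q > 0\<close>, so that
  \<open>0\<^sup>q = 0\<close> and \<open>\<infinity>\<^sup>q = \<infinity>\<close>.\<close>

definition ennpowr :: "ennreal \<Rightarrow> real \<Rightarrow> ennreal" where
  "ennpowr x q = (if x = \<infinity> then \<infinity> else ennreal (enn2real x powr q))"

text \<open>The infimum ranges over all countable (finite, empty or infinite) families of open balls of
  positive radius covering \<open>E\<close>, indexed by an arbitrary set of natural numbers.\<close>

definition hausdorff_content :: "real \<Rightarrow> 'a::euclidean_space set \<Rightarrow> ennreal" where
  "hausdorff_content \<delta> E =
     Inf {(\<Sum>\<^sub>\<infinity>i\<in>I. ennreal (r i powr \<delta>)) | (I :: nat set) (x :: nat \<Rightarrow> 'a) (r :: nat \<Rightarrow> real).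
            (\<forall>i\<in>I. 0 < r i) \<and> E \<subseteq> (\<Union>i\<in>I. ball (x i) (r i))}"

definition choquet_integral ::
    "real \<Rightarrow> 'a::euclidean_space set \<Rightarrow> ('a \<Rightarrow> ennreal) \<Rightarrow> ennreal" where
  "choquet_integral \<delta> \<Omega> g =
     (\<integral>\<^sup>+t\<in>{0<..}. hausdorff_content \<delta> {x \<in> \<Omega>. g x > ennreal t} \<partial>lborel)"

text \<open>In \<^typ>\<open>ennreal\<close>, \<open>a / 0 = \<infinity>\<close> for \<open>a > 0\<close> and \<open>0 / 0 = 0\<close>, which fixes the value of
  the kernel on the diagonal \<open>y = x\<close>.\<close>

definition content_riesz_potential ::
    "real \<Rightarrow> real \<Rightarrow> ('a::euclidean_space \<Rightarrow> ereal) \<Rightarrow> 'a \<Rightarrow> ennreal" where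
  "content_riesz_potential \<delta> \<alpha> f x =
     choquet_integral \<delta> UNIV (\<lambda>y. e2ennreal \<bar>f y\<bar> / ennreal (norm (x - y) powr (\<delta> - \<alpha>)))"

end

theory Submission
  imports Defs
begin

text \<open>
  Write \<open>H\<close> for the \<open>\<delta>\<close>-dimensional content, \<open>E\<^sub>k = {|f| > 2\<^sup>k}\<close> for integers \<open>k\<close>, and
  \<open>h\<^sub>k(x, s) = H (E\<^sub>k \<inter> B(x, s))\<close>. Content is only countably subadditive, and its Choquet integral is
  not additive, so the potential of a sum is not split. Instead \<open>|f|\<close> is dominated by the
  supremum of the functions \<open>2\<^bsup>k+1\<^esup> 1\<^bsub>E\<^sub>k\<^esub>\<close>, and the integral of a supremum is at most the sum of the integrals,
  because superlevel sets of a supremum are unions. Cutting the layer-cake integral at geometric points,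
  this gives (\<open>riesz_potential_le_level_sum\<close>) the bound
  \<open>R f(x) \<le> c \<Sum>\<^sub>j 2\<^bsup>j(\<delta>-\<alpha>)\<^esup> S(x, 2\<^bsup>-j\<^esup>)\<close> with \<open>S(x, s) = \<Sum>\<^sub>k 2\<^sup>k h\<^sub>k(x, s)\<close>.

  The rest is Hedberg's argument with \<open>S(x, s)\<close> in the place of the integral of \<open>|f|\<close> over a ball. Let \<open>A\<close>
  bound the integral of \<open>|f|\<^sup>p\<close>. On the one hand \<open>H(E\<^sub>k)\<close> is at most a multiple of \<open>A 2\<^bsup>-kp\<^esup>\<close> and
  \<open>h\<^sub>k(x, s) \<le> s\<^sup>\<delta>\<close>, so that \<open>S(x, s) \<le> c A\<^bsup>1/p\<^esup> s\<^bsup>\<delta>-\<delta>/p\<^esup>\<close> (\<open>level_sum_le_norm\<close>).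
  On the other hand, if \<open>S(x, s) \<le> c 2\<^sup>l s\<^sup>\<delta>\<close> for all \<open>s\<close> (a bound by \<open>2\<^sup>l\<close> on a maximal function), then
  taking the better of the two bounds at each scale and summing gives
  \<open>R f(x) \<le> c A\<^bsup>\<alpha>/\<delta>\<^esup> 2\<^bsup>l(1-\<alpha>p/\<delta>)\<^esup>\<close> (\<open>riesz_potential_le_of_level_sums\<close>).

  It remains to bound the content of the set of points where the maximal bound fails. Since \<open>H\<close> is not
  additive on disjoint balls, the covering argument is applied to a genuine measure. Cover \<open>E\<^sub>k\<close> almost optimally by balls
  \<open>B(y\<^bsub>ki\<^esub>, r\<^bsub>ki\<^esub>)\<close>, put the mass \<open>2\<^sup>k r\<^bsub>ki\<^esub>\<^sup>\<delta>\<close> at \<open>y\<^bsub>ki\<^esub>\<close> for \<open>k \<ge> l\<close>, and apply Vitali's lemma to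
  the resulting discrete measure (\<open>hausdorff_content_maximal_weak_type\<close>). The levels \<open>k < l\<close>
  contribute at most \<open>c 2\<^sup>l s\<^sup>\<delta>\<close> anyway. For \<open>k \<ge> l\<close> the doubled balls are discarded: if \<open>x\<close> lies in none of them,
  each covering ball that meets \<open>B(x, s)\<close> has radius below \<open>s\<close> and centre in \<open>B(x, 2s)\<close>, so \<open>h\<^sub>k(x, s)\<close> is at most the
  total \<open>r\<^bsub>ki\<^esub>\<^sup>\<delta>\<close> of the centres in that ball. The exceptional set thus has content at most
  \<open>c \<Sum>\<^bsub>k\<ge>l\<^esub> 2\<^bsup>k-l\<^esup> m\<^sub>k\<close> with \<open>m\<^sub>k = \<Sum>\<^sub>i r\<^bsub>ki\<^esub>\<^sup>\<delta>\<close>, and summing against \<open>2\<^bsup>lp\<^esup>\<close> over \<open>l\<close> (a geometric sum,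
  as \<open>p > 1\<close>) gives a multiple of
  \<open>\<Sum>\<^sub>k 2\<^bsup>kp\<^esup> m\<^sub>k\<close>, hence of \<open>A\<close>. By the pointwise bound this sum controls the
  integral of the required power of the potential.
\<close>

section \<open>Sums over countable index types\<close>

text \<open>Unordered sums of extended nonnegative reals, as integrals for the counting measure; interchanging
  two of them, or a sum and an integral, is then an instance of Tonelli's theorem.\<close>

abbreviation isum :: "('i \<Rightarrow> ennreal) \<Rightarrow> ennreal" where
  "isum f \<equiv> (\<integral>\<^sup>+i. f i \<partial>count_space UNIV)"

lemma isum_swap:
  fixes f :: "'i::countable \<Rightarrow> 'j \<Rightarrow> ennreal"
  shows "isum (\<lambda>j. isum (\<lambda>i. f i j)) = isum (\<lambda>i. isum (\<lambda>j. f i j))"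
  by (rule nn_integral_count_space_nn_integral) auto

lemma isum_mono: "(\<And>i. f i \<le> g i) \<Longrightarrow> isum f \<le> isum g"
  by (rule nn_integral_mono) auto

lemma isum_ge_term: "f i \<le> isum f"
  by (rule nn_integral_ge_point) auto

lemma isum_pair:
  fixes f :: "'i \<Rightarrow> 'j \<Rightarrow> ennreal"
  shows "isum (\<lambda>z. f (fst z) (snd z)) = isum (\<lambda>i. isum (\<lambda>j. f i j))"
  using nn_integral_fst_count_space[of "\<lambda>z. f (fst z) (snd z)"] by simp

lemma isum_inj_le:
  assumes "inj h"
  shows "isum (\<lambda>i. f (h i)) \<le> isum f"
proof -
  have "isum (\<lambda>i. f (h i)) = (\<integral>\<^sup>+j. f j \<partial>count_space (range h))"
    by (rule nn_integral_bij_count_space) (use assms in \<open>simp add: inj_on_imp_bij_betw\<close>)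
  also have "\<dots> \<le> isum f"
    by (subst nn_integral_count_space_indicator)
       (auto intro!: nn_integral_mono split: split_indicator)
  finally show ?thesis .
qed

lemma exists_positive_isum_le_1:
  "\<exists>w :: 'i::countable \<Rightarrow> real. (\<forall>i. w i > 0) \<and> isum (\<lambda>i. ennreal (w i)) \<le> 1"
proof (intro exI conjI allI)
  define w where "w = (\<lambda>i::'i. (1/2::real) ^ Suc (to_nat i))"
  show "w i > 0" for i by (simp add: w_def)
  have "isum (\<lambda>i. ennreal (w i)) \<le> isum (\<lambda>n::nat. ennreal ((1/2) ^ Suc n))"
    unfolding w_def by (rule isum_inj_le) simp
  also have "\<dots> = (\<Sum>n. ennreal ((1/2) ^ Suc n))"
    by (rule nn_integral_count_space_nat)
  also have "\<dots> = ennreal 1"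
    by (rule suminf_ennreal_eq) (use power_half_series in auto)
  finally show "isum (\<lambda>i. ennreal (w i)) \<le> 1" by simp
qed

lemma infsum_ennreal_nat:
  fixes f :: "nat \<Rightarrow> ennreal"
  shows "infsum f I = (\<integral>\<^sup>+i. f i \<partial>count_space I)"
proof -
  have "infsum f I = infsum (\<lambda>i. f i * indicator I i) UNIV"
    by (rule infsum_cong_neutral) auto
  also have "((\<lambda>i. f i * indicator I i) has_sum infsum (\<lambda>i. f i * indicator I i) UNIV) UNIV"
    by (intro has_sum_infsum nonneg_summable_on_complete) auto
  hence "(\<lambda>i. f i * indicator I i) sums infsum (\<lambda>i. f i * indicator I i) UNIV"
    by (rule has_sum_imp_sums)
  hence "infsum (\<lambda>i. f i * indicator I i) UNIV = (\<Sum>i. f i * indicator I i)"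
    by (simp add: sums_iff)
  also have "\<dots> = isum (\<lambda>i. f i * indicator I i)"
    by (rule nn_integral_count_space_nat[symmetric])
  also have "\<dots> = (\<integral>\<^sup>+i. f i \<partial>count_space I)"
    by (cases "I = UNIV") (simp_all add: nn_integral_count_space_indicator)
  finally show ?thesis .
qed

section \<open>Hausdorff content and a weak type inequality\<close>

lemma hausdorff_content_mono:
  "E \<subseteq> F \<Longrightarrow> hausdorff_content \<delta> E \<le> hausdorff_content \<delta> F"
  unfolding hausdorff_content_def by (rule Inf_superset_mono) blast

lemma hausdorff_content_le_cover:
  fixes x :: "'i \<Rightarrow> 'a::euclidean_space"
  assumes "countable J" and r: "\<And>i. i \<in> J \<Longrightarrow> 0 \<le> r i" and E: "E \<subseteq> (\<Union>i\<in>J. ball (x i) (r i))"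
  shows "hausdorff_content \<delta> E \<le> (\<integral>\<^sup>+i. ennreal (r i powr \<delta>) \<partial>count_space J)"
proof -
  define J' where "J' = {i\<in>J. 0 < r i}"
  have "countable J'" using assms(1) unfolding J'_def by auto
  define h where "h = to_nat_on J'"
  define k where "k = from_nat_into J'"
  have inj: "inj_on h J'" unfolding h_def using \<open>countable J'\<close> by (rule inj_on_to_nat_on)
  have kh: "k (h i) = i" if "i \<in> J'" for i
    using that \<open>countable J'\<close> unfolding k_def h_def by simp
  have "hausdorff_content \<delta> E \<le> (\<Sum>\<^sub>\<infinity>i\<in>h ` J'. ennreal (r (k i) powr \<delta>))"
    unfolding hausdorff_content_def
  proof (rule Inf_lower, intro CollectI exI conjI)
    show "E \<subseteq> (\<Union>i\<in>h ` J'. ball (x (k i)) (r (k i)))"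
    proof
      fix z assume "z \<in> E"
      then obtain i where i: "i \<in> J" "z \<in> ball (x i) (r i)" using E by blast
      hence "0 < r i" by (metis ball_eq_empty empty_iff linorder_not_le)
      hence "i \<in> J'" using i by (simp add: J'_def)
      thus "z \<in> (\<Union>i\<in>h ` J'. ball (x (k i)) (r (k i)))"
        using i kh by auto
    qed
  qed (auto simp: kh, auto simp: J'_def)
  also have "\<dots> = (\<integral>\<^sup>+i. ennreal (r (k i) powr \<delta>) \<partial>count_space (h ` J'))"
    by (rule infsum_ennreal_nat)
  also have "\<dots> = (\<integral>\<^sup>+i. ennreal (r (k (h i)) powr \<delta>) \<partial>count_space J')"
    by (rule nn_integral_bij_count_space[symmetric]) (use inj in \<open>simp add: inj_on_imp_bij_betw\<close>)
  also have "\<dots> = (\<integral>\<^sup>+i. ennreal (r i powr \<delta>) \<partial>count_space J')"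
    by (rule nn_integral_cong) (simp add: kh)
  also have "\<dots> = (\<integral>\<^sup>+i. ennreal (r i powr \<delta>) \<partial>count_space J)"
  proof (rule nn_integral_count_space_eq)
    show "ennreal (r i powr \<delta>) = 0" if "i \<in> J - J'" for i
      using that r[of i] unfolding J'_def by (cases "r i = 0") auto
  qed (auto simp: J'_def)
  finally show ?thesis .
qed

text \<open>The radius \<open>0\<close> is admitted so that every cover can be indexed by all natural numbers; such
  balls are empty and contribute \<open>0\<close>.\<close>

lemma hausdorff_content_less_imp_cover:
  fixes E :: "'a::euclidean_space set"
  assumes "hausdorff_content \<delta> E < c"
  obtains x :: "nat \<Rightarrow> 'a" and r :: "nat \<Rightarrow> real"
  where "\<And>i. 0 \<le> r i" "E \<subseteq> (\<Union>i. ball (x i) (r i))" "isum (\<lambda>i. ennreal (r i powr \<delta>)) < c"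
proof -
  obtain I :: "nat set" and x :: "nat \<Rightarrow> 'a" and r :: "nat \<Rightarrow> real"
    where r: "\<forall>i\<in>I. 0 < r i" and E: "E \<subseteq> (\<Union>i\<in>I. ball (x i) (r i))"
      and c: "(\<Sum>\<^sub>\<infinity>i\<in>I. ennreal (r i powr \<delta>)) < c"
    using assms unfolding hausdorff_content_def Inf_less_iff by blast
  define r' where "r' = (\<lambda>i. if i \<in> I then r i else 0)"
  have "isum (\<lambda>i. ennreal (r' i powr \<delta>)) = (\<integral>\<^sup>+i. ennreal (r' i powr \<delta>) \<partial>count_space I)"
    by (rule nn_integral_count_space_eq) (auto simp: r'_def)
  also have "\<dots> = (\<integral>\<^sup>+i. ennreal (r i powr \<delta>) \<partial>count_space I)"
    by (rule nn_integral_cong) (auto simp: r'_def)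
  finally have "isum (\<lambda>i. ennreal (r' i powr \<delta>)) < c"
    using c by (simp add: infsum_ennreal_nat)
  moreover have "0 \<le> r' i" for i using r by (auto simp: r'_def less_imp_le)
  moreover have "E \<subseteq> (\<Union>i. ball (x i) (r' i))"
  proof
    fix z assume "z \<in> E"
    then obtain i where "i \<in> I" "z \<in> ball (x i) (r i)" using E by blast
    thus "z \<in> (\<Union>i. ball (x i) (r' i))" by (intro UN_I[of i]) (auto simp: r'_def)
  qed
  ultimately show thesis using that by blast
qed

lemma hausdorff_content_less_imp_covers:
  fixes E :: "'k \<Rightarrow> 'a::euclidean_space set"
  assumes "\<And>k. hausdorff_content \<delta> (E k) < c k"
  shows "\<exists>(x :: 'k \<Rightarrow> nat \<Rightarrow> 'a) r. (\<forall>k i. 0 \<le> r k i) \<and> (\<forall>k. E k \<subseteq> (\<Union>i. ball (x k i) (r k i))) \<and>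
    (\<forall>k. isum (\<lambda>i. ennreal (r k i powr \<delta>)) < c k)"
proof -
  \<comment> \<open>a single choice function for the pairs of centres and radii\<close>
  define Q where "Q = (\<lambda>k (z :: (nat \<Rightarrow> 'a) \<times> (nat \<Rightarrow> real)). (\<forall>i. 0 \<le> snd z i) \<and>
    E k \<subseteq> (\<Union>i. ball (fst z i) (snd z i)) \<and> isum (\<lambda>i. ennreal (snd z i powr \<delta>)) < c k)"
  have "\<exists>z. Q k z" for k
  proof (rule hausdorff_content_less_imp_cover[OF assms[of k]])
    fix x :: "nat \<Rightarrow> 'a" and r :: "nat \<Rightarrow> real"
    assume "\<And>i. 0 \<le> r i" "E k \<subseteq> (\<Union>i. ball (x i) (r i))" "isum (\<lambda>i. ennreal (r i powr \<delta>)) < c k"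
    hence "Q k (x, r)" by (simp add: Q_def)
    thus "\<exists>z. Q k z" ..
  qed
  hence "\<exists>z. \<forall>k. Q k (z k)" by (intro choice allI)
  then obtain z where z: "\<forall>k. Q k (z k)" ..
  show ?thesis
    by (rule exI[of _ "\<lambda>k. fst (z k)"], rule exI[of _ "\<lambda>k. snd (z k)"]) (use z in \<open>simp add: Q_def\<close>)
qed

lemma hausdorff_content_ball_le:
  "0 \<le> s \<Longrightarrow> hausdorff_content \<delta> (ball x s) \<le> ennreal (s powr \<delta>)"
  using hausdorff_content_le_cover[of "{()}" "\<lambda>_. s" "ball x s" "\<lambda>_. x" \<delta>]
  by (simp add: nn_integral_count_space_finite)

lemma hausdorff_content_UNION_le:
  fixes E :: "'k::countable \<Rightarrow> 'a::euclidean_space set"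
  shows "hausdorff_content \<delta> (\<Union>k. E k) \<le> isum (\<lambda>k. hausdorff_content \<delta> (E k))"
proof (cases "isum (\<lambda>k. hausdorff_content \<delta> (E k)) = \<infinity>")
  case False
  obtain w where w: "\<And>k::'k. w k > 0" "isum (\<lambda>k. ennreal (w k)) \<le> 1"
    using exists_positive_isum_le_1[where 'i = 'k] by auto
  show ?thesis
  proof (rule ennreal_le_epsilon)
    fix e :: real assume "0 < e"
    have less: "hausdorff_content \<delta> (E k) < hausdorff_content \<delta> (E k) + ennreal (e * w k)" for k
    proof -
      have "hausdorff_content \<delta> (E k) < \<infinity>"
        using False isum_ge_term[of "\<lambda>k. hausdorff_content \<delta> (E k)" k]
        by (simp add: less_top top_unique)
      thus ?thesis using \<open>0 < e\<close> w(1)[of k] by (simp add: less_top[symmetric])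
    qed
    obtain x :: "'k \<Rightarrow> nat \<Rightarrow> 'a" and r where r: "\<forall>k i. 0 \<le> r k i"
      and cov: "\<forall>k. E k \<subseteq> (\<Union>i. ball (x k i) (r k i))"
      and s: "\<forall>k. isum (\<lambda>i. ennreal (r k i powr \<delta>)) < hausdorff_content \<delta> (E k) + ennreal (e * w k)"
      using hausdorff_content_less_imp_covers[of \<delta> E, OF less] by (elim exE conjE)
    have "hausdorff_content \<delta> (\<Union>k. E k)
          \<le> isum (\<lambda>z. ennreal (r (fst z) (snd z) powr \<delta>))"
    proof (rule hausdorff_content_le_cover)
      show "(\<Union>k. E k) \<subseteq> (\<Union>z. ball (x (fst z) (snd z)) (r (fst z) (snd z)))"
      proof
        fix y assume "y \<in> (\<Union>k. E k)"
        then obtain k where "y \<in> E k" by blast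
        then obtain i where "y \<in> ball (x k i) (r k i)" using cov by blast
        thus "y \<in> (\<Union>z. ball (x (fst z) (snd z)) (r (fst z) (snd z)))"
          by (intro UN_I[of "(k, i)"]) auto
      qed
    qed (use r in auto)
    also have "\<dots> = isum (\<lambda>k. isum (\<lambda>i. ennreal (r k i powr \<delta>)))"
      by (rule isum_pair)
    also have "\<dots> \<le> isum (\<lambda>k. hausdorff_content \<delta> (E k) + ennreal e * ennreal (w k))"
    proof (rule isum_mono)
      show "isum (\<lambda>i. ennreal (r k i powr \<delta>)) \<le> hausdorff_content \<delta> (E k) + ennreal e * ennreal (w k)" for k
        using s[rule_format, of k] \<open>0 < e\<close> w(1)[of k] by (simp add: ennreal_mult less_imp_le)
    qed
    also have "\<dots> = isum (\<lambda>k. hausdorff_content \<delta> (E k)) + ennreal e * isum (\<lambda>k. ennreal (w k))"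
      by (simp add: nn_integral_add nn_integral_cmult)
    also have "\<dots> \<le> isum (\<lambda>k. hausdorff_content \<delta> (E k)) + ennreal e * 1"
      by (intro add_left_mono mult_left_mono w) auto
    finally show "hausdorff_content \<delta> (\<Union>k. E k) \<le> isum (\<lambda>k. hausdorff_content \<delta> (E k)) + ennreal e"
      by simp
  qed
qed simp

lemma hausdorff_content_Un_le:
  "hausdorff_content \<delta> (A \<union> B) \<le> hausdorff_content \<delta> A + hausdorff_content \<delta> B"
  using hausdorff_content_UNION_le[of \<delta> "\<lambda>b. if b then A else B"]
  by (simp add: nn_integral_count_space_finite UNIV_bool Un_commute add.commute)

text \<open>The weak type \<open>(1,1)\<close> inequality for the maximal function of a measure with respect to
  content. Additivity of \<open>\<mu>\<close> on the disjoint balls selected by Vitali's lemma is essential: content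
  is only subadditive.\<close>

lemma hausdorff_content_maximal_weak_type:
  fixes \<mu> :: "'a::euclidean_space measure"
  assumes sets: "sets \<mu> = sets borel" and "0 < \<delta>" "0 < c"
  shows "hausdorff_content \<delta> {x. \<exists>s>0. ennreal (c * s powr \<delta>) < emeasure \<mu> (ball x s)}
         \<le> ennreal (5 powr \<delta> / c) * emeasure \<mu> UNIV" (is "hausdorff_content \<delta> ?W \<le> _")
proof (cases "emeasure \<mu> UNIV = \<infinity>")
  case True
  thus ?thesis using \<open>0 < c\<close> by (simp add: ennreal_mult_top)
next
  case False
  then obtain M where M: "emeasure \<mu> UNIV = ennreal M" "0 \<le> M"
    by (cases "emeasure \<mu> UNIV") auto
  define K where "K = {z :: 'a \<times> real. 0 < snd z \<and>
    ennreal (c * snd z powr \<delta>) < emeasure \<mu> (ball (fst z) (snd z))}"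
  \<comment> \<open>Vitali's lemma needs bounded radii; finiteness of \<open>\<mu>\<close> provides the bound\<close>
  have bound: "s \<le> (M / c) powr (1/\<delta>)" if "(x, s) \<in> K" for x s
  proof -
    have s: "0 < s" "ennreal (c * s powr \<delta>) < emeasure \<mu> (ball x s)"
      using that by (auto simp: K_def)
    have "emeasure \<mu> (ball x s) \<le> emeasure \<mu> UNIV"
      by (rule emeasure_mono) (auto simp: sets)
    hence "ennreal (c * s powr \<delta>) \<le> ennreal M" using s(2) M(1) by simp
    hence "c * s powr \<delta> \<le> M" using M(2) by (simp add: ennreal_le_iff)
    hence "s powr \<delta> \<le> M / c" using \<open>0 < c\<close> by (simp add: field_simps)
    hence "(s powr \<delta>) powr (1/\<delta>) \<le> (M / c) powr (1/\<delta>)"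
      using \<open>0 < \<delta>\<close> by (intro powr_mono2) auto
    thus ?thesis using s(1) \<open>0 < \<delta>\<close> by (simp add: powr_powr)
  qed
  have "?W \<subseteq> (\<Union>z\<in>K. ball (fst z) (snd z))"
  proof
    fix x assume "x \<in> ?W"
    then obtain s where "0 < s" "ennreal (c * s powr \<delta>) < emeasure \<mu> (ball x s)" by blast
    thus "x \<in> (\<Union>z\<in>K. ball (fst z) (snd z))" by (intro UN_I[of "(x, s)"]) (auto simp: K_def)
  qed
  then obtain C where C: "countable C" "C \<subseteq> K"
    "pairwise (\<lambda>i j. disjnt (ball (fst i) (snd i)) (ball (fst j) (snd j))) C"
    "?W \<subseteq> (\<Union>z\<in>C. ball (fst z) (5 * snd z))"
    by (rule Vitali_covering_lemma_balls[where B = "(M / c) powr (1/\<delta>)"])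
       (use bound in \<open>auto simp: K_def\<close>)
  have "hausdorff_content \<delta> ?W \<le> (\<integral>\<^sup>+z. ennreal ((5 * snd z) powr \<delta>) \<partial>count_space C)"
    by (rule hausdorff_content_le_cover) (use C in \<open>auto simp: K_def\<close>)
  also have "\<dots> \<le> (\<integral>\<^sup>+z. ennreal (5 powr \<delta> / c) * emeasure \<mu> (ball (fst z) (snd z)) \<partial>count_space C)"
  proof (rule nn_integral_mono)
    fix z assume "z \<in> space (count_space C)"
    hence z: "0 < snd z" "ennreal (c * snd z powr \<delta>) < emeasure \<mu> (ball (fst z) (snd z))"
      using C(2) by (auto simp: K_def)
    have "ennreal ((5 * snd z) powr \<delta>) = ennreal (5 powr \<delta> / c) * ennreal (c * snd z powr \<delta>)"
      using z(1) \<open>0 < c\<close> by (simp add: ennreal_mult[symmetric] powr_mult)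
    also have "\<dots> \<le> ennreal (5 powr \<delta> / c) * emeasure \<mu> (ball (fst z) (snd z))"
      using z(2) by (intro mult_left_mono) auto
    finally show "ennreal ((5 * snd z) powr \<delta>)
      \<le> ennreal (5 powr \<delta> / c) * emeasure \<mu> (ball (fst z) (snd z))" .
  qed
  also have "\<dots> = ennreal (5 powr \<delta> / c)
      * (\<integral>\<^sup>+z. emeasure \<mu> (ball (fst z) (snd z)) \<partial>count_space C)"
    by (rule nn_integral_cmult) auto
  also have "(\<integral>\<^sup>+z. emeasure \<mu> (ball (fst z) (snd z)) \<partial>count_space C)
      = emeasure \<mu> (\<Union>z\<in>C. ball (fst z) (snd z))"
    by (rule emeasure_UN_countable[symmetric])
       (use C in \<open>auto simp: sets disjoint_family_on_def pairwise_def disjnt_def\<close>)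
  also have "\<dots> \<le> emeasure \<mu> UNIV"
    by (rule emeasure_mono) (auto simp: sets)
  finally show ?thesis by (simp add: mult_left_mono)
qed

section \<open>Geometric sums and the layer-cake formula\<close>

lemma isum_shift:
  fixes f :: "int \<Rightarrow> ennreal"
  shows "isum (\<lambda>j. f (j - i)) = isum f"
proof (rule nn_integral_bij_count_space)
  show "bij (\<lambda>j. j - i)"
    by (rule bij_betwI[where g = "\<lambda>j. j + i"]) auto
qed

lemma two_sided_geometric_sum_bound:
  fixes a :: real
  assumes "0 < a"
  obtains K :: real where "0 < K"
    "\<And>i::int. isum (\<lambda>j. ennreal (2 powr (- a * real_of_int \<bar>j - i\<bar>))) \<le> ennreal K"
proof -
  define q :: real where "q = 2 powr (-a)"
  have q: "0 < q" "q < 1" using assms by (auto simp: q_def powr_less_one)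
  define f where "f = (\<lambda>j::int. ennreal (2 powr (- a * real_of_int \<bar>j\<bar>)))"
  have powq: "2 powr (- a * real n) = q ^ n" for n :: nat
    using q(1) by (simp add: powr_realpow[symmetric]) (simp add: q_def powr_powr)
  have half: "(\<integral>\<^sup>+j. f j \<partial>count_space (range h)) = ennreal (1 / (1 - q))"
    if h: "inj h" "\<And>n. \<bar>h n\<bar> = int n" for h :: "nat \<Rightarrow> int"
  proof -
    have "(\<integral>\<^sup>+j. f j \<partial>count_space (range h)) = isum (\<lambda>n. f (h n))"
      by (rule nn_integral_bij_count_space[symmetric]) (use h in \<open>simp add: inj_on_imp_bij_betw\<close>)
    also have "\<dots> = (\<Sum>n. ennreal (q ^ n))"
      by (subst nn_integral_count_space_nat)
         (simp add: f_def powq[symmetric] h(2) of_int_abs[symmetric] del: of_int_abs)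
    also have "\<dots> = ennreal (1 / (1 - q))"
      by (rule suminf_ennreal_eq) (use q geometric_sums[of q] in auto)
    finally show ?thesis .
  qed
  have "isum f \<le> isum (\<lambda>j. f j * indicator (range int) j + f j * indicator (range (\<lambda>n. - int n)) j)"
  proof (rule isum_mono)
    fix j :: int
    have "j \<in> range int \<or> j \<in> range (\<lambda>n. - int n)"
      by (cases j rule: int_cases2) auto
    thus "f j \<le> f j * indicator (range int) j + f j * indicator (range (\<lambda>n. - int n)) j"
      by (auto simp: indicator_def)
  qed
  also have "\<dots> = isum (\<lambda>j. f j * indicator (range int) j) + isum (\<lambda>j. f j * indicator (range (\<lambda>n. - int n)) j)"
    by (rule nn_integral_add) auto
  also have "isum (\<lambda>j. f j * indicator (range int) j) = (\<integral>\<^sup>+j. f j \<partial>count_space (range int))"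
    by (rule nn_integral_count_space_indicator[symmetric]) simp
  also have "\<dots> = ennreal (1 / (1 - q))" by (rule half) auto
  also have "isum (\<lambda>j. f j * indicator (range (\<lambda>n. - int n)) j)
      = (\<integral>\<^sup>+j. f j \<partial>count_space (range (\<lambda>n. - int n)))"
    by (rule nn_integral_count_space_indicator[symmetric]) simp
  also have "\<dots> = ennreal (1 / (1 - q))" by (rule half) (auto simp: inj_def)
  also have "ennreal (1 / (1 - q)) + ennreal (1 / (1 - q)) = ennreal (2 / (1 - q))"
    using q by (subst ennreal_plus[symmetric]) auto
  finally have "isum f \<le> ennreal (2 / (1 - q))" .
  moreover have "isum (\<lambda>j. ennreal (2 powr (- a * real_of_int \<bar>j - i\<bar>))) = isum f" for i
    using isum_shift[of f i] by (simp add: f_def)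
  ultimately show thesis
    using that[of "2 / (1 - q)"] q by simp
qed

text \<open>The sum is dominated by its terms near the crossing point of the two geometric sequences, whose common
  value there is \<open>u\<^bsup>b/(a+b)\<^esup> v\<^bsup>a/(a+b)\<^esup>\<close>.\<close>

lemma isum_min_geometric_le:
  fixes a b :: real
  assumes "0 < a" "0 < b"
  shows "\<exists>K::real. 0 < K \<and> (\<forall>u v. 0 < u \<longrightarrow> 0 < v \<longrightarrow>
      isum (\<lambda>j::int. ennreal (min (u * 2 powr (a * real_of_int j)) (v * 2 powr (- b * real_of_int j))))
        \<le> ennreal (K * (u powr (b / (a + b)) * v powr (a / (a + b)))))"
proof -
  define c where "c = min a b"
  have "0 < c" using assms by (simp add: c_def)
  then obtain K0 :: real where K0: "0 < K0"
    "\<And>i::int. isum (\<lambda>j. ennreal (2 powr (- c * real_of_int \<bar>j - i\<bar>))) \<le> ennreal K0"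
    by (rule two_sided_geometric_sum_bound) blast
  show ?thesis
  proof (intro exI[of _ "2 powr c * K0"] conjI allI impI)
    show "0 < 2 powr c * K0" using K0 by simp
    fix u v :: real assume uv: "0 < u" "0 < v"
    \<comment> \<open>\<open>\<tau>\<close> is the real index at which the two sequences cross, and \<open>V\<close> their common value there\<close>
    define \<tau> where "\<tau> = log 2 (v / u) / (a + b)"
    define V where "V = u powr (b / (a + b)) * v powr (a / (a + b))"
    have "0 < V" using uv by (simp add: V_def)
    have vu: "2 powr ((a + b) * \<tau>) = v / u"
      using assms uv by (simp add: \<tau>_def)
    have exps: "b / (a + b) = 1 - a / (a + b)"
      using assms by (simp add: field_simps)
    have Vu: "u * 2 powr (a * \<tau>) = V"
    proof -
      have "2 powr (a * \<tau>) = (2 powr ((a + b) * \<tau>)) powr (a / (a + b))"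
        using assms by (simp add: powr_powr mult.commute)
      also have "\<dots> = v powr (a / (a + b)) / u powr (a / (a + b))"
        using uv vu by (simp add: powr_divide)
      finally show ?thesis
        using uv unfolding V_def exps by (simp add: powr_diff)
    qed
    have Vv: "v * 2 powr (- b * \<tau>) = V"
    proof -
      have "v = u * 2 powr ((a + b) * \<tau>)" using vu uv by simp
      hence "v * 2 powr (- b * \<tau>) = u * (2 powr ((a + b) * \<tau>) * 2 powr (- b * \<tau>))"
        by simp
      also have "\<dots> = u * 2 powr (a * \<tau>)"
        by (subst powr_add[symmetric]) (simp add: algebra_simps)
      finally show ?thesis using Vu by simp
    qed
    define i where "i = \<lfloor>\<tau>\<rfloor>"
    have term_le: "min (u * 2 powr (a * real_of_int j)) (v * 2 powr (- b * real_of_int j))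
        \<le> (2 powr c * V) * 2 powr (- c * real_of_int \<bar>j - i\<bar>)" for j :: int
    proof -
      have 1: "u * 2 powr (a * real_of_int j) = V * 2 powr (a * (real_of_int j - \<tau>))"
        unfolding Vu[symmetric] mult.assoc powr_add[symmetric] by (simp add: algebra_simps)
      have 2: "v * 2 powr (- b * real_of_int j) = V * 2 powr (- b * (real_of_int j - \<tau>))"
        unfolding Vv[symmetric] mult.assoc powr_add[symmetric] by (simp add: algebra_simps)
      have dist: "real_of_int \<bar>j - i\<bar> - 1 \<le> \<bar>real_of_int j - \<tau>\<bar>"
        unfolding i_def by linarith
      have "min (a * (real_of_int j - \<tau>)) (- b * (real_of_int j - \<tau>)) \<le> - c * \<bar>real_of_int j - \<tau>\<bar>"
      proof (cases "real_of_int j - \<tau> \<ge> 0")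
        case True
        hence "c * (real_of_int j - \<tau>) \<le> b * (real_of_int j - \<tau>)"
          by (intro mult_right_mono) (auto simp: c_def)
        thus ?thesis using True by (auto simp: min_le_iff_disj)
      next
        case False
        hence "a * (real_of_int j - \<tau>) \<le> c * (real_of_int j - \<tau>)"
          by (intro mult_right_mono_neg) (auto simp: c_def)
        moreover have "c * (real_of_int j - \<tau>) = - c * \<bar>real_of_int j - \<tau>\<bar>"
          using False by (simp add: algebra_simps)
        ultimately show ?thesis by linarith
      qed
      also have "\<dots> \<le> - c * (real_of_int \<bar>j - i\<bar> - 1)"
        using dist \<open>0 < c\<close> by simp
      finally have "min (a * (real_of_int j - \<tau>)) (- b * (real_of_int j - \<tau>))
          \<le> c + - c * real_of_int \<bar>j - i\<bar>" by (simp add: algebra_simps)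
      hence "min (2 powr (a * (real_of_int j - \<tau>))) (2 powr (- b * (real_of_int j - \<tau>)))
          \<le> 2 powr (c + - c * real_of_int \<bar>j - i\<bar>)"
        by (auto simp: min_le_iff_disj)
      also have "\<dots> = 2 powr c * 2 powr (- c * real_of_int \<bar>j - i\<bar>)" by (rule powr_add)
      finally have "V * min (2 powr (a * (real_of_int j - \<tau>))) (2 powr (- b * (real_of_int j - \<tau>)))
          \<le> V * (2 powr c * 2 powr (- c * real_of_int \<bar>j - i\<bar>))"
        using \<open>0 < V\<close> by (intro mult_left_mono) auto
      moreover have "V * min x y = min (V * x) (V * y)" for x y
        using \<open>0 < V\<close> by (simp add: min_mult_distrib_left)
      ultimately show ?thesis
        unfolding 1 2 by (simp only: mult_ac)
    qed
    have "isum (\<lambda>j. ennreal (min (u * 2 powr (a * real_of_int j)) (v * 2 powr (- b * real_of_int j))))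
      \<le> isum (\<lambda>j. ennreal (2 powr c * V) * ennreal (2 powr (- c * real_of_int \<bar>j - i\<bar>)))"
      by (rule isum_mono) (use term_le in \<open>simp add: ennreal_mult[symmetric] \<open>0 < V\<close> less_imp_le ennreal_leI\<close>)
    also have "\<dots> = ennreal (2 powr c * V) * isum (\<lambda>j. ennreal (2 powr (- c * real_of_int \<bar>j - i\<bar>)))"
      by (rule nn_integral_cmult) auto
    also have "\<dots> \<le> ennreal (2 powr c * V) * ennreal K0"
      by (intro mult_left_mono K0) auto
    also have "\<dots> = ennreal (2 powr c * K0 * V)"
      using \<open>0 < V\<close> K0 by (simp add: ennreal_mult[symmetric] mult_ac)
    finally show "isum (\<lambda>j. ennreal (min (u * 2 powr (a * real_of_int j)) (v * 2 powr (- b * real_of_int j))))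
        \<le> ennreal (2 powr c * K0 * (u powr (b / (a + b)) * v powr (a / (a + b))))"
      by (simp add: V_def)
  qed
qed

lemma geometric_interval_exists:
  fixes b \<rho> t :: real
  assumes "0 < b" "1 < \<rho>" "0 < t"
  obtains j :: int where "b * \<rho> powr real_of_int j < t" "t \<le> b * \<rho> powr (real_of_int j + 1)"
proof -
  define s where "s = log \<rho> (t / b)"
  have t: "t = b * \<rho> powr s" using assms by (simp add: s_def)
  define j where "j = \<lceil>s\<rceil> - 1"
  have "real_of_int j < s" "s \<le> real_of_int j + 1" unfolding j_def by linarith+
  thus thesis using that[of j] assms unfolding t by simp
qed

lemma emeasure_geometric_interval:
  fixes b \<rho> :: real
  assumes "0 < b" "1 < \<rho>"
  shows "emeasure lborel {b * \<rho> powr x<..b * \<rho> powr (x + 1)} = ennreal ((\<rho> - 1) * b * \<rho> powr x)"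
proof -
  have "b * \<rho> powr x \<le> b * \<rho> powr (x + 1)" using assms by simp
  hence "emeasure lborel {b * \<rho> powr x<..b * \<rho> powr (x + 1)}
      = ennreal (b * \<rho> powr (x + 1) - b * \<rho> powr x)" by simp
  also have "b * \<rho> powr (x + 1) - b * \<rho> powr x = (\<rho> - 1) * b * \<rho> powr x"
    using assms by (simp add: powr_add algebra_simps)
  finally show ?thesis .
qed

text \<open>Upper discretisation of a layer-cake integral. Each \<open>\<phi> k\<close> is antitone, hence at most its
  value at the left end of each interval of a geometric partition. The partition may depend on \<open>k\<close>, and
  \<open>\<psi>\<close> need not be measurable.\<close>

lemma nn_integral_halfline_le_isum:
  fixes \<phi> :: "'k::countable \<Rightarrow> real \<Rightarrow> ennreal" and \<rho> :: real
  assumes le: "\<And>t. 0 < t \<Longrightarrow> \<psi> t \<le> isum (\<lambda>k. \<phi> k t)"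
    and anti: "\<And>k s t. 0 < s \<Longrightarrow> s \<le> t \<Longrightarrow> \<phi> k t \<le> \<phi> k s"
    and b: "\<And>k. 0 < b k" and \<rho>: "1 < \<rho>"
  shows "(\<integral>\<^sup>+t\<in>{0<..}. \<psi> t \<partial>lborel)
    \<le> isum (\<lambda>k. isum (\<lambda>j::int. ennreal ((\<rho> - 1) * b k * \<rho> powr real_of_int j)
          * \<phi> k (b k * \<rho> powr real_of_int j)))"
proof -
  define I where "I = (\<lambda>k (j::int). {b k * \<rho> powr real_of_int j<..b k * \<rho> powr (real_of_int j + 1)})"
  define v where "v = (\<lambda>k (j::int). \<phi> k (b k * \<rho> powr real_of_int j))"
  have "(\<integral>\<^sup>+t\<in>{0<..}. \<psi> t \<partial>lborel) \<le> (\<integral>\<^sup>+t. isum (\<lambda>k. isum (\<lambda>j. v k j * indicator (I k j) t)) \<partial>lborel)"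
  proof (rule nn_integral_mono)
    fix t :: real
    have "\<psi> t \<le> isum (\<lambda>k. isum (\<lambda>j. v k j * indicator (I k j) t))" if t: "0 < t"
    proof -
      have "\<psi> t \<le> isum (\<lambda>k. \<phi> k t)" using le t .
      also have "\<dots> \<le> isum (\<lambda>k. isum (\<lambda>j. v k j * indicator (I k j) t))"
      proof (rule isum_mono)
        fix k
        obtain j :: int where j: "b k * \<rho> powr real_of_int j < t" "t \<le> b k * \<rho> powr (real_of_int j + 1)"
          using geometric_interval_exists[OF b \<rho> t] .
        have "\<phi> k t \<le> v k j"
          unfolding v_def using j b[of k] \<rho> by (intro anti) auto
        also have "\<dots> = v k j * indicator (I k j) t" using j by (simp add: I_def)
        also have "\<dots> \<le> isum (\<lambda>j. v k j * indicator (I k j) t)" by (rule isum_ge_term)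
        finally show "\<phi> k t \<le> isum (\<lambda>j. v k j * indicator (I k j) t)" .
      qed
      finally show ?thesis .
    qed
    thus "\<psi> t * indicator {0<..} t \<le> isum (\<lambda>k. isum (\<lambda>j. v k j * indicator (I k j) t))"
      by (auto split: split_indicator)
  qed
  also have "\<dots> = (\<integral>\<^sup>+t. isum (\<lambda>z. v (fst z) (snd z) * indicator (I (fst z) (snd z)) t) \<partial>lborel)"
    by (intro nn_integral_cong isum_pair[symmetric])
  also have "\<dots> = isum (\<lambda>z. \<integral>\<^sup>+t. v (fst z) (snd z) * indicator (I (fst z) (snd z)) t \<partial>lborel)"
    by (rule nn_integral_count_space_nn_integral) (auto simp: I_def)
  also have "\<dots> = isum (\<lambda>k. isum (\<lambda>j. \<integral>\<^sup>+t. v k j * indicator (I k j) t \<partial>lborel))"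
    by (rule isum_pair)
  also have "\<dots> = isum (\<lambda>k. isum (\<lambda>j::int. ennreal ((\<rho> - 1) * b k * \<rho> powr real_of_int j)
          * \<phi> k (b k * \<rho> powr real_of_int j)))"
  proof (intro nn_integral_cong)
    fix k j
    have "(\<integral>\<^sup>+t. v k j * indicator (I k j) t \<partial>lborel) = v k j * emeasure lborel (I k j)"
      by (rule nn_integral_cmult_indicator) (simp add: I_def)
    also have "emeasure lborel (I k j) = ennreal ((\<rho> - 1) * b k * \<rho> powr real_of_int j)"
      unfolding I_def by (rule emeasure_geometric_interval[OF b \<rho>])
    finally show "(\<integral>\<^sup>+t. v k j * indicator (I k j) t \<partial>lborel)
      = ennreal ((\<rho> - 1) * b k * \<rho> powr real_of_int j) * \<phi> k (b k * \<rho> powr real_of_int j)"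
      unfolding v_def by (simp only: mult.commute)
  qed
  finally show ?thesis .
qed

text \<open>The matching lower discretisation, by values at right ends.\<close>

lemma isum_le_nn_integral_halfline:
  fixes \<phi> :: "real \<Rightarrow> ennreal" and \<rho> :: real
  assumes anti: "\<And>s t. 0 < s \<Longrightarrow> s \<le> t \<Longrightarrow> \<phi> t \<le> \<phi> s"
    and b: "0 < b" and \<rho>: "1 < \<rho>"
  shows "isum (\<lambda>j::int. ennreal ((\<rho> - 1) * b * \<rho> powr real_of_int j)
          * \<phi> (b * \<rho> powr (real_of_int j + 1))) \<le> (\<integral>\<^sup>+t\<in>{0<..}. \<phi> t \<partial>lborel)"
proof -
  define I where "I = (\<lambda>j::int. {b * \<rho> powr real_of_int j<..b * \<rho> powr (real_of_int j + 1)})"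
  define v where "v = (\<lambda>j::int. \<phi> (b * \<rho> powr (real_of_int j + 1)))"
  have "isum (\<lambda>j::int. ennreal ((\<rho> - 1) * b * \<rho> powr real_of_int j)
          * \<phi> (b * \<rho> powr (real_of_int j + 1))) = isum (\<lambda>j. \<integral>\<^sup>+t. v j * indicator (I j) t \<partial>lborel)"
  proof (intro nn_integral_cong)
    fix j
    have "(\<integral>\<^sup>+t. v j * indicator (I j) t \<partial>lborel) = v j * emeasure lborel (I j)"
      by (rule nn_integral_cmult_indicator) (simp add: I_def)
    also have "emeasure lborel (I j) = ennreal ((\<rho> - 1) * b * \<rho> powr real_of_int j)"
      unfolding I_def by (rule emeasure_geometric_interval[OF b \<rho>])
    finally show "ennreal ((\<rho> - 1) * b * \<rho> powr real_of_int j) * \<phi> (b * \<rho> powr (real_of_int j + 1))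
      = (\<integral>\<^sup>+t. v j * indicator (I j) t \<partial>lborel)"
      unfolding v_def by (simp only: mult.commute)
  qed
  also have "\<dots> = (\<integral>\<^sup>+t. isum (\<lambda>j. v j * indicator (I j) t) \<partial>lborel)"
    by (rule nn_integral_count_space_nn_integral[symmetric]) (auto simp: I_def)
  also have "\<dots> \<le> (\<integral>\<^sup>+t\<in>{0<..}. \<phi> t \<partial>lborel)"
  proof (rule nn_integral_mono)
    fix t :: real
    show "isum (\<lambda>j. v j * indicator (I j) t) \<le> \<phi> t * indicator {0<..} t"
    proof (cases "0 < t")
      case True
      obtain k :: int where k: "b * \<rho> powr real_of_int k < t" "t \<le> b * \<rho> powr (real_of_int k + 1)"
        using geometric_interval_exists[OF b \<rho> True] .
      have uniq: "j = k" if "t \<in> I j" for j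
      proof -
        have j: "b * \<rho> powr real_of_int j < t" "t \<le> b * \<rho> powr (real_of_int j + 1)"
          using that by (auto simp: I_def)
        have "b * \<rho> powr real_of_int j < b * \<rho> powr (real_of_int k + 1)"
             "b * \<rho> powr real_of_int k < b * \<rho> powr (real_of_int j + 1)"
          using j k by linarith+
        hence "real_of_int j < real_of_int k + 1" "real_of_int k < real_of_int j + 1"
          using b \<rho> by simp_all
        thus "j = k" by linarith
      qed
      have "isum (\<lambda>j. v j * indicator (I j) t) \<le> isum (\<lambda>j. v k * indicator {k} j)"
      proof (rule isum_mono)
        show "v j * indicator (I j) t \<le> v k * indicator {k} j" for j
        proof (cases "t \<in> I j")
          case True
          thus ?thesis using uniq[OF True] by simp
        qed simp
      qed
      also have "\<dots> = v k" by (simp add: nn_integral_cmult_indicator)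
      also have "\<dots> \<le> \<phi> t" unfolding v_def using k True by (intro anti) auto
      finally show ?thesis using True by simp
    next
      case False
      have "t \<notin> I j" for j
      proof -
        have "0 \<le> b * \<rho> powr real_of_int j" using b by simp
        thus ?thesis using False unfolding I_def by simp
      qed
      thus ?thesis by simp
    qed
  qed
  finally show ?thesis .
qed

section \<open>Superlevel sets and the potential\<close>

lemma less_ennpowr_iff:
  assumes "0 \<le> s" "0 < q"
  shows "ennreal (s powr q) < ennpowr x q \<longleftrightarrow> ennreal s < x"
proof (cases x)
  case (real z)
  hence "s powr q < z powr q \<longleftrightarrow> s < z"
    using assms by (metis linorder_not_less powr_less_mono2 powr_mono2 less_imp_le)
  thus ?thesis using real assms by (simp add: ennpowr_def ennreal_less_iff)
qed (simp add: ennpowr_def)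

lemma ennpowr_le:
  assumes "x \<le> ennreal z" "0 \<le> z" "0 < q"
  shows "ennpowr x q \<le> ennreal (z powr q)"
  using less_ennpowr_iff[of z q x] assms by (simp add: linorder_not_less[symmetric])

text \<open>Almost optimal covers of all dyadic superlevel sets at once. The summand \<open>1\<close> in the constant
  pays for the excess over the contents, distributed over the levels by summable weights.\<close>

lemma superlevel_sets_cover:
  fixes g :: "'a::euclidean_space \<Rightarrow> ennreal"
  assumes "0 < p" "0 < A"
    and int: "choquet_integral \<delta> UNIV (\<lambda>x. ennpowr (g x) p) \<le> ennreal A"
  shows "\<exists>(y :: int \<Rightarrow> nat \<Rightarrow> 'a) r. (\<forall>k i. 0 \<le> r k i) \<and>
    (\<forall>k. {x. ennreal (2 powr real_of_int k) < g x} \<subseteq> (\<Union>i. ball (y k i) (r k i))) \<and>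
    isum (\<lambda>k. ennreal (2 powr (p * real_of_int k)) * isum (\<lambda>i. ennreal (r k i powr \<delta>)))
      \<le> ennreal ((1 / (1 - 2 powr (- p)) + 1) * A)"
proof -
  define \<phi> where "\<phi> = (\<lambda>t. hausdorff_content \<delta> {x. ennreal t < ennpowr (g x) p})"
  define \<theta> :: real where "\<theta> = 1 - 2 powr (- p)"
  have "0 < \<theta>" using \<open>0 < p\<close> by (simp add: \<theta>_def powr_less_one)
  define h where "h = (\<lambda>k::int. hausdorff_content \<delta> {x. ennreal (2 powr real_of_int k) < g x})"
  have \<phi>h: "\<phi> (2 powr (p * real_of_int k)) = h k" for k
    using less_ennpowr_iff[of "2 powr real_of_int k" p] \<open>0 < p\<close>
    by (simp add: \<phi>_def h_def powr_powr mult.commute)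
  have "isum (\<lambda>j::int. ennreal ((2 powr p - 1) * 1 * (2 powr p) powr real_of_int j)
      * \<phi> (1 * (2 powr p) powr (real_of_int j + 1))) \<le> (\<integral>\<^sup>+t\<in>{0<..}. \<phi> t \<partial>lborel)"
  proof (rule isum_le_nn_integral_halfline)
    show "\<phi> t \<le> \<phi> s" if "0 < s" "s \<le> t" for s t
      unfolding \<phi>_def
      by (rule hausdorff_content_mono) (use that in \<open>auto intro: le_less_trans ennreal_leI\<close>)
  qed (use \<open>0 < p\<close> in auto)
  also have "\<dots> \<le> ennreal A"
    using int by (simp add: choquet_integral_def \<phi>_def)
  also have "(\<lambda>j::int. ennreal ((2 powr p - 1) * 1 * (2 powr p) powr real_of_int j)
      * \<phi> (1 * (2 powr p) powr (real_of_int j + 1)))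
    = (\<lambda>j. ennreal (\<theta> * 2 powr (p * real_of_int (j - (-1)))) * h (j - (-1)))"
  proof
    fix j :: int
    have "(2 powr p - 1) * 1 * (2 powr p) powr real_of_int j = \<theta> * 2 powr (p * real_of_int (j - (-1)))"
    proof -
      have "2 powr (p * real_of_int (j - (-1))) = 2 powr p * 2 powr (p * real_of_int j)"
        unfolding powr_add[symmetric] by (simp add: algebra_simps)
      moreover have "\<theta> * 2 powr p = 2 powr p - 1"
        by (simp add: \<theta>_def powr_minus left_diff_distrib)
      ultimately show ?thesis by (simp add: powr_powr mult.assoc[symmetric])
    qed
    moreover have "1 * (2 powr p) powr (real_of_int j + 1) = 2 powr (p * real_of_int (j - (-1)))"
      by (simp add: powr_powr)
    ultimately show "ennreal ((2 powr p - 1) * 1 * (2 powr p) powr real_of_int j)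
      * \<phi> (1 * (2 powr p) powr (real_of_int j + 1))
      = ennreal (\<theta> * 2 powr (p * real_of_int (j - (-1)))) * h (j - (-1))"
      by (simp only: \<phi>h)
  qed
  \<comment> \<open>the right ends of the intervals are the heights \<open>2\<^bsup>pk\<^esup>\<close> after the index shift by one\<close>
  also have "isum \<dots> = isum (\<lambda>k. ennreal (\<theta> * 2 powr (p * real_of_int k)) * h k)"
    by (rule isum_shift)
  also have "\<dots> = ennreal \<theta> * isum (\<lambda>k. ennreal (2 powr (p * real_of_int k)) * h k)"
    using \<open>0 < \<theta>\<close> by (simp add: ennreal_mult mult.assoc nn_integral_cmult)
  finally have "ennreal (1 / \<theta>) * (ennreal \<theta> * isum (\<lambda>k. ennreal (2 powr (p * real_of_int k)) * h k))
      \<le> ennreal (1 / \<theta>) * ennreal A" by (intro mult_left_mono) auto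
  hence hsum: "isum (\<lambda>k. ennreal (2 powr (p * real_of_int k)) * h k) \<le> ennreal (A / \<theta>)"
    using \<open>0 < \<theta>\<close> \<open>0 < A\<close> by (simp add: mult.assoc[symmetric] ennreal_mult[symmetric])
  obtain w where w: "\<And>k::int. w k > 0" "isum (\<lambda>k. ennreal (w k)) \<le> 1"
    using exists_positive_isum_le_1[where 'i = int] by auto
  have less: "hausdorff_content \<delta> {x. ennreal (2 powr real_of_int k) < g x}
      < h k + ennreal (A * w k * 2 powr (- p * real_of_int k))" for k
  proof -
    have "ennreal (2 powr (p * real_of_int k)) * h k \<le> ennreal (A / \<theta>)"
      using isum_ge_term[of "\<lambda>k. ennreal (2 powr (p * real_of_int k)) * h k" k] hsum by (rule order_trans)
    hence "h k \<noteq> \<infinity>" by (auto simp: ennreal_mult_top top_unique)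
    thus ?thesis
      using \<open>0 < A\<close> w(1)[of k] by (simp add: h_def less_top)
  qed
  obtain y :: "int \<Rightarrow> nat \<Rightarrow> 'a" and r where r: "\<forall>k i. 0 \<le> r k i"
    and cov: "\<forall>k. {x. ennreal (2 powr real_of_int k) < g x} \<subseteq> (\<Union>i. ball (y k i) (r k i))"
    and s: "\<forall>k. isum (\<lambda>i. ennreal (r k i powr \<delta>)) < h k + ennreal (A * w k * 2 powr (- p * real_of_int k))"
    using hausdorff_content_less_imp_covers[of \<delta> "\<lambda>k. {x. ennreal (2 powr real_of_int k) < g x}", OF less]
    by (elim exE conjE)
  have "isum (\<lambda>k. ennreal (2 powr (p * real_of_int k)) * isum (\<lambda>i. ennreal (r k i powr \<delta>)))
    \<le> isum (\<lambda>k. ennreal (2 powr (p * real_of_int k)) * h k + ennreal A * ennreal (w k))"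
  proof (rule isum_mono)
    fix k
    have "ennreal (2 powr (p * real_of_int k)) * isum (\<lambda>i. ennreal (r k i powr \<delta>))
      \<le> ennreal (2 powr (p * real_of_int k)) * (h k + ennreal (A * w k * 2 powr (- p * real_of_int k)))"
      using s[rule_format, of k] by (intro mult_left_mono less_imp_le) auto
    also have "\<dots> = ennreal (2 powr (p * real_of_int k)) * h k
        + ennreal (2 powr (p * real_of_int k) * (A * w k * 2 powr (- p * real_of_int k)))"
      using \<open>0 < A\<close> w(1)[of k] by (simp add: distrib_left ennreal_mult less_imp_le)
    also have "2 powr (p * real_of_int k) * (A * w k * 2 powr (- p * real_of_int k)) = A * w k"
      by (simp add: powr_minus)
    also have "ennreal (A * w k) = ennreal A * ennreal (w k)"
      using \<open>0 < A\<close> w(1)[of k] by (simp add: ennreal_mult less_imp_le)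
    finally show "ennreal (2 powr (p * real_of_int k)) * isum (\<lambda>i. ennreal (r k i powr \<delta>))
      \<le> ennreal (2 powr (p * real_of_int k)) * h k + ennreal A * ennreal (w k)" .
  qed
  also have "\<dots> = isum (\<lambda>k. ennreal (2 powr (p * real_of_int k)) * h k) + ennreal A * isum (\<lambda>k. ennreal (w k))"
    by (simp add: nn_integral_add nn_integral_cmult)
  also have "\<dots> \<le> ennreal (A / \<theta>) + ennreal A * 1"
    by (intro add_mono mult_left_mono hsum w) auto
  also have "\<dots> = ennreal ((1 / \<theta> + 1) * A)"
    using \<open>0 < A\<close> \<open>0 < \<theta>\<close> by (simp add: ennreal_plus[symmetric] algebra_simps del: ennreal_plus)
  finally show ?thesis
    using r cov unfolding \<theta>_def by (intro exI[of _ y] exI[of _ r] conjI)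
qed

text \<open>If \<open>|f(y)| / |x - y|\<^bsup>\<delta>-\<alpha>\<^esup> > t\<close>, then for a suitable
  \<open>k\<close> the point \<open>y\<close> lies in the superlevel set at height \<open>2\<^sup>k\<close> and in the
  ball about \<open>x\<close> of radius \<open>(2\<^bsup>k+1\<^esup>/t)\<^bsup>1/(\<delta>-\<alpha>)\<^esup>\<close>.
  The points \<open>y = x\<close> and \<open>|f(y)| = \<infinity>\<close> are covered by the same inclusion.\<close>

lemma riesz_potential_le_level_sum:
  fixes f :: "'a::euclidean_space \<Rightarrow> ereal"
  assumes "\<alpha> < \<delta>"
  defines "E \<equiv> \<lambda>k::int. {y. ennreal (2 powr real_of_int k) < e2ennreal \<bar>f y\<bar>}"
  shows "content_riesz_potential \<delta> \<alpha> f x \<le> isum (\<lambda>j::int.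
      ennreal (2 * (2 powr (\<delta> - \<alpha>) - 1) * 2 powr ((\<delta> - \<alpha>) * real_of_int j))
      * isum (\<lambda>k. ennreal (2 powr real_of_int k) * hausdorff_content \<delta> (E k \<inter> ball x (2 powr - real_of_int j))))"
proof -
  define \<beta> where "\<beta> = \<delta> - \<alpha>"
  have "0 < \<beta>" using assms by (simp add: \<beta>_def)
  define c where "c = 2 * (2 powr \<beta> - 1 :: real)"
  have "0 \<le> c" using \<open>0 < \<beta>\<close> by (simp add: c_def ge_one_powr_ge_zero)
  define b :: "int \<Rightarrow> real" where "b = (\<lambda>k. 2 powr (real_of_int k + 1))"
  define \<phi> where "\<phi> = (\<lambda>k t. hausdorff_content \<delta> (E k \<inter> ball x ((b k / t) powr (1 / \<beta>))))"
  define T where "T = (\<lambda>t. {y. ennreal t < e2ennreal \<bar>f y\<bar> / ennreal (norm (x - y) powr \<beta>)})"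
  have "content_riesz_potential \<delta> \<alpha> f x = (\<integral>\<^sup>+t\<in>{0<..}. hausdorff_content \<delta> (T t) \<partial>lborel)"
    by (simp add: content_riesz_potential_def choquet_integral_def T_def \<beta>_def)
  also have "\<dots> \<le> isum (\<lambda>k. isum (\<lambda>j::int. ennreal ((2 powr \<beta> - 1) * b k * (2 powr \<beta>) powr real_of_int j)
      * \<phi> k (b k * (2 powr \<beta>) powr real_of_int j)))"
  proof (rule nn_integral_halfline_le_isum)
    fix t :: real assume "0 < t"
    have "T t \<subseteq> (\<Union>k. E k \<inter> ball x ((b k / t) powr (1 / \<beta>)))"
    proof
      fix y assume "y \<in> T t"
      hence y: "ennreal t < e2ennreal \<bar>f y\<bar> / ennreal (norm (x - y) powr \<beta>)" by (simp add: T_def)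
      have "\<exists>k::int. ennreal (2 powr real_of_int k) < e2ennreal \<bar>f y\<bar> \<and> t * norm (x - y) powr \<beta> < b k"
      proof (cases "e2ennreal \<bar>f y\<bar>")
        case top
        define k where "k = \<lceil>log 2 (t * norm (x - y) powr \<beta> + 1)\<rceil>"
        have "t * norm (x - y) powr \<beta> < t * norm (x - y) powr \<beta> + 1" by simp
        also have "\<dots> = 2 powr log 2 (t * norm (x - y) powr \<beta> + 1)"
          using \<open>0 < t\<close> by (subst powr_log_cancel) (auto intro: add_nonneg_pos)
        also have "\<dots> \<le> b k"
          unfolding b_def k_def by (intro powr_mono) linarith+
        finally show ?thesis using top by auto
      next
        case (real z)
        have "z \<noteq> 0" using y real by (auto simp: ennreal_zero_divide)
        hence "0 < z" using real by simp
        obtain k :: int where k: "1 * 2 powr real_of_int k < z" "z \<le> 1 * 2 powr (real_of_int k + 1)"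
          by (rule geometric_interval_exists[of 1 2 z]) (use \<open>0 < z\<close> in auto)
        have "t * norm (x - y) powr \<beta> < b k"
        proof (cases "x = y")
          case False
          hence n: "0 < norm (x - y) powr \<beta>" by simp
          hence "ennreal t < ennreal (z / norm (x - y) powr \<beta>)"
            using y real by (simp add: divide_ennreal)
          hence "t < z / norm (x - y) powr \<beta>" using \<open>0 < t\<close> by (simp add: ennreal_less_iff)
          hence "t * norm (x - y) powr \<beta> < z" using n by (simp add: field_simps)
          thus ?thesis using k by (simp add: b_def)
        qed (simp add: b_def)
        thus ?thesis using k real \<open>0 < z\<close> by (auto simp: ennreal_less_iff)
      qed
      then obtain k :: int where k: "ennreal (2 powr real_of_int k) < e2ennreal \<bar>f y\<bar>"
        "t * norm (x - y) powr \<beta> < b k" by blast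
      have "norm (x - y) powr \<beta> < b k / t" using k(2) \<open>0 < t\<close> by (simp add: field_simps)
      hence "(norm (x - y) powr \<beta>) powr (1 / \<beta>) < (b k / t) powr (1 / \<beta>)"
        using \<open>0 < \<beta>\<close> by (intro powr_less_mono2) auto
      hence "norm (x - y) < (b k / t) powr (1 / \<beta>)" using \<open>0 < \<beta>\<close> by (simp add: powr_powr)
      thus "y \<in> (\<Union>k. E k \<inter> ball x ((b k / t) powr (1 / \<beta>)))"
        using k(1) by (auto simp: E_def dist_norm)
    qed
    hence "hausdorff_content \<delta> (T t) \<le> hausdorff_content \<delta> (\<Union>k. E k \<inter> ball x ((b k / t) powr (1 / \<beta>)))"
      by (rule hausdorff_content_mono)
    also have "\<dots> \<le> isum (\<lambda>k. \<phi> k t)" unfolding \<phi>_def by (rule hausdorff_content_UNION_le)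
    finally show "hausdorff_content \<delta> (T t) \<le> isum (\<lambda>k. \<phi> k t)" .
  next
    fix k :: int and s t :: real assume "0 < s" "s \<le> t"
    hence "(b k / t) powr (1 / \<beta>) \<le> (b k / s) powr (1 / \<beta>)"
      using \<open>0 < \<beta>\<close> by (intro powr_mono2 divide_left_mono) (auto simp: b_def)
    thus "\<phi> k t \<le> \<phi> k s"
      unfolding \<phi>_def by (intro hausdorff_content_mono) auto
  qed (use \<open>0 < \<beta>\<close> in \<open>auto simp: b_def\<close>)
  also have "\<dots> = isum (\<lambda>k. isum (\<lambda>j. ennreal (c * 2 powr (\<beta> * real_of_int j))
      * (ennreal (2 powr real_of_int k) * hausdorff_content \<delta> (E k \<inter> ball x (2 powr - real_of_int j)))))"
  proof (intro nn_integral_cong)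
    fix k j :: int
    have "(2 powr \<beta> - 1) * b k * (2 powr \<beta>) powr real_of_int j
        = c * 2 powr (\<beta> * real_of_int j) * 2 powr real_of_int k"
      by (simp add: c_def b_def powr_powr powr_add)
    moreover have "(b k / (b k * (2 powr \<beta>) powr real_of_int j)) powr (1 / \<beta>) = 2 powr - real_of_int j"
    proof -
      have "b k / (b k * (2 powr \<beta>) powr real_of_int j) = 2 powr (- (\<beta> * real_of_int j))"
        by (simp add: b_def powr_powr powr_minus field_simps)
      thus ?thesis using \<open>0 < \<beta>\<close> by (simp add: powr_powr)
    qed
    ultimately show "ennreal ((2 powr \<beta> - 1) * b k * (2 powr \<beta>) powr real_of_int j)
        * \<phi> k (b k * (2 powr \<beta>) powr real_of_int j)
      = ennreal (c * 2 powr (\<beta> * real_of_int j))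
        * (ennreal (2 powr real_of_int k) * hausdorff_content \<delta> (E k \<inter> ball x (2 powr - real_of_int j)))"
      using \<open>0 \<le> c\<close> by (simp add: \<phi>_def ennreal_mult mult.assoc)
  qed
  also have "\<dots> = isum (\<lambda>j. isum (\<lambda>k. ennreal (c * 2 powr (\<beta> * real_of_int j))
      * (ennreal (2 powr real_of_int k) * hausdorff_content \<delta> (E k \<inter> ball x (2 powr - real_of_int j)))))"
    by (rule isum_swap)
  also have "\<dots> = isum (\<lambda>j. ennreal (c * 2 powr (\<beta> * real_of_int j))
      * isum (\<lambda>k. ennreal (2 powr real_of_int k) * hausdorff_content \<delta> (E k \<inter> ball x (2 powr - real_of_int j))))"
    by (intro nn_integral_cong nn_integral_cmult) auto
  finally show ?thesis by (simp add: c_def \<beta>_def)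
qed

text \<open>Localisation of a cover: outside the doubled balls, only balls smaller than \<open>s\<close> can meet
  \<open>ball x s\<close>, and their centres lie in \<open>ball x (2 * s)\<close>.\<close>

lemma hausdorff_content_Int_ball_le_centers:
  fixes y :: "'i::countable \<Rightarrow> 'a::euclidean_space"
  assumes r: "\<And>i. 0 \<le> r i" and E: "E \<subseteq> (\<Union>i. ball (y i) (r i))"
    and x: "x \<notin> (\<Union>i. ball (y i) (2 * r i))"
  shows "hausdorff_content \<delta> (E \<inter> ball x s) \<le> isum (\<lambda>i. ennreal (r i powr \<delta>) * indicator (ball x (2 * s)) (y i))"
proof -
  define J where "J = {i. y i \<in> ball x (2 * s)}"
  have "E \<inter> ball x s \<subseteq> (\<Union>i\<in>J. ball (y i) (r i))"
  proof
    fix z assume z: "z \<in> E \<inter> ball x s"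
    then obtain i where i: "dist (y i) z < r i" using E by auto
    have "2 * r i \<le> dist (y i) x" using x by (simp add: linorder_not_less)
    moreover have "dist (y i) x \<le> dist (y i) z + dist x z" by (rule dist_triangle2)
    moreover have "dist x z < s" using z by simp
    ultimately have "dist (y i) x < 2 * s" using i by linarith
    hence "i \<in> J" by (simp add: J_def dist_commute)
    thus "z \<in> (\<Union>i\<in>J. ball (y i) (r i))" using i by auto
  qed
  hence "hausdorff_content \<delta> (E \<inter> ball x s) \<le> (\<integral>\<^sup>+i. ennreal (r i powr \<delta>) \<partial>count_space J)"
    by (intro hausdorff_content_le_cover r) auto
  also have "\<dots> = isum (\<lambda>i. ennreal (r i powr \<delta>) * indicator J i)"
    by (cases "J = UNIV") (simp_all add: nn_integral_count_space_indicator)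
  also have "\<dots> = isum (\<lambda>i. ennreal (r i powr \<delta>) * indicator (ball x (2 * s)) (y i))"
    by (intro nn_integral_cong) (simp add: J_def indicator_def)
  finally show ?thesis .
qed

lemma hausdorff_content_discrete_maximal_weak_type:
  fixes w :: "'i::countable \<Rightarrow> ennreal" and y :: "'i \<Rightarrow> 'a::euclidean_space"
  assumes "0 < \<delta>" "0 < c"
  shows "hausdorff_content \<delta>
      {x. \<exists>s>0. ennreal (c * s powr \<delta>) < isum (\<lambda>i. w i * indicator (ball x s) (y i))}
    \<le> ennreal (5 powr \<delta> / c) * isum w"
proof -
  define \<mu> where "\<mu> = distr (density (count_space UNIV) w) borel y"
  have "emeasure \<mu> B = isum (\<lambda>i. w i * indicator B (y i))" if "B \<in> sets borel" for B
    using that unfolding \<mu>_def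
    by (subst emeasure_distr) (auto simp: emeasure_density indicator_def intro!: nn_integral_cong)
  thus ?thesis
    using hausdorff_content_maximal_weak_type[of \<mu> \<delta> c] assms by (simp add: \<mu>_def)
qed

section \<open>The exceptional set and the pointwise inequality\<close>

text \<open>For covers by balls with centres \<open>y k i\<close> and radii \<open>r k i\<close>, one cover for each
  level \<open>k\<close>: the union of the doubled balls of level at least \<open>l\<close>, together with the set
  where the maximal function \<open>sup\<^sub>s \<mu>(B(x, s)) / s\<^sup>\<delta>\<close> of the measure
  \<open>\<mu>\<close> with mass \<open>2\<^sup>k (r k i)\<^sup>\<delta>\<close> at \<open>y k i\<close> (\<open>k
  \<ge> l\<close>) exceeds \<open>2\<^sup>l\<close>.\<close>

definition exceptional_set ::
    "real \<Rightarrow> (int \<Rightarrow> nat \<Rightarrow> 'a::euclidean_space) \<Rightarrow> (int \<Rightarrow> nat \<Rightarrow> real) \<Rightarrow> int \<Rightarrow> 'a set" where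
  "exceptional_set \<delta> y r l =
     (\<Union>k\<in>{l..}. \<Union>i. ball (y k i) (2 * r k i)) \<union>
     {x. \<exists>s>0. ennreal (2 powr real_of_int l * s powr \<delta>) <
        isum (\<lambda>k. indicator {l..} k * ennreal (2 powr real_of_int k) *
          isum (\<lambda>i. ennreal (r k i powr \<delta>) * indicator (ball x s) (y k i)))}"

lemma hausdorff_content_exceptional_set_le:
  fixes y :: "int \<Rightarrow> nat \<Rightarrow> 'a::euclidean_space"
  assumes "0 < \<delta>" and r: "\<And>k i. 0 \<le> r k i"
  shows "hausdorff_content \<delta> (exceptional_set \<delta> y r l) \<le> ennreal (2 powr \<delta> + 5 powr \<delta>) *
    isum (\<lambda>k. indicator {l..} k * ennreal (2 powr real_of_int (k - l)) * isum (\<lambda>i. ennreal (r k i powr \<delta>)))"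
proof -
  define m where "m = (\<lambda>k. isum (\<lambda>i. ennreal (r k i powr \<delta>)))"
  define S where "S = isum (\<lambda>k. indicator {l..} k * ennreal (2 powr real_of_int (k - l)) * m k)"
  define F where "F = (\<Union>k\<in>{l..}. \<Union>i. ball (y k i) (2 * r k i))"
  define W where "W = {x. \<exists>s>0. ennreal (2 powr real_of_int l * s powr \<delta>) <
        isum (\<lambda>k. indicator {l..} k * ennreal (2 powr real_of_int k) *
          isum (\<lambda>i. ennreal (r k i powr \<delta>) * indicator (ball x s) (y k i)))}"
  \<comment> \<open>radius \<open>0\<close> removes the levels below \<open>l\<close>\<close>
  define \<rho> where "\<rho> = (\<lambda>z. if l \<le> fst z then 2 * r (fst z) (snd z) else 0)"
  have "hausdorff_content \<delta> F \<le> isum (\<lambda>z. ennreal (\<rho> z powr \<delta>))"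
  proof (rule hausdorff_content_le_cover[where x = "\<lambda>z. y (fst z) (snd z)"])
    show "F \<subseteq> (\<Union>z. ball (y (fst z) (snd z)) (\<rho> z))"
    proof
      fix x assume "x \<in> F"
      then obtain k i where "l \<le> k" "x \<in> ball (y k i) (2 * r k i)" unfolding F_def by auto
      thus "x \<in> (\<Union>z. ball (y (fst z) (snd z)) (\<rho> z))"
        by (intro UN_I[of "(k, i)"]) (auto simp: \<rho>_def)
    qed
  qed (use r in \<open>auto simp: \<rho>_def\<close>)
  also have "\<dots> = isum (\<lambda>k. isum (\<lambda>i. ennreal (\<rho> (k, i) powr \<delta>)))"
    using isum_pair[of "\<lambda>k i. ennreal (\<rho> (k, i) powr \<delta>)"] by simp
  also have "\<dots> \<le> isum (\<lambda>k. ennreal (2 powr \<delta>) * (indicator {l..} k * ennreal (2 powr real_of_int (k - l)) * m k))"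
  proof (rule isum_mono)
    fix k :: int
    show "isum (\<lambda>i. ennreal (\<rho> (k, i) powr \<delta>))
      \<le> ennreal (2 powr \<delta>) * (indicator {l..} k * ennreal (2 powr real_of_int (k - l)) * m k)"
    proof (cases "l \<le> k")
      case True
      have "isum (\<lambda>i. ennreal (\<rho> (k, i) powr \<delta>)) = isum (\<lambda>i. ennreal (2 powr \<delta>) * ennreal (r k i powr \<delta>))"
        using True r by (simp add: \<rho>_def powr_mult ennreal_mult)
      also have "\<dots> = ennreal (2 powr \<delta>) * m k" unfolding m_def by (rule nn_integral_cmult) auto
      also have "\<dots> \<le> ennreal (2 powr \<delta>) * (ennreal (2 powr real_of_int (k - l)) * m k)"
      proof (rule mult_left_mono)
        \<comment> \<open>the weight \<open>2\<^bsup>k-l\<^esup> \<ge> 1\<close> may be inserted, which brings this part into the form of the other\<close>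
        have "1 \<le> ennreal (2 powr real_of_int (k - l))"
          using True by (simp add: ge_one_powr_ge_zero)
        thus "m k \<le> ennreal (2 powr real_of_int (k - l)) * m k"
          using mult_right_mono[of 1 "ennreal (2 powr real_of_int (k - l))" "m k"] by simp
      qed simp
      finally show ?thesis using True by simp
    qed (simp add: \<rho>_def)
  qed
  also have "\<dots> = ennreal (2 powr \<delta>) * S" unfolding S_def by (rule nn_integral_cmult) auto
  finally have F: "hausdorff_content \<delta> F \<le> ennreal (2 powr \<delta>) * S" .
  define w where "w = (\<lambda>z. indicator {l..} (fst z) * ennreal (2 powr real_of_int (fst z))
      * ennreal (r (fst z) (snd z) powr \<delta>))"
  have pair: "isum (\<lambda>z. w z * indicator (ball x s) (y (fst z) (snd z)))
    = isum (\<lambda>k. indicator {l..} k * ennreal (2 powr real_of_int k) *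
          isum (\<lambda>i. ennreal (r k i powr \<delta>) * indicator (ball x s) (y k i)))" for x s
    unfolding w_def
    using isum_pair[of "\<lambda>k i. indicator {l..} k * ennreal (2 powr real_of_int k) *
      ennreal (r k i powr \<delta>) * indicator (ball x s) (y k i)"]
    by (simp add: mult.assoc nn_integral_cmult)
  have "hausdorff_content \<delta> W \<le> ennreal (5 powr \<delta> / 2 powr real_of_int l) * isum w"
    using hausdorff_content_discrete_maximal_weak_type[of \<delta> "2 powr real_of_int l" w
        "\<lambda>z. y (fst z) (snd z)"] \<open>0 < \<delta>\<close>
    unfolding pair W_def by simp
  also have "isum w = isum (\<lambda>k. indicator {l..} k * ennreal (2 powr real_of_int k) * m k)"
    unfolding w_def m_def
    using isum_pair[of "\<lambda>k i. indicator {l..} k * ennreal (2 powr real_of_int k) * ennreal (r k i powr \<delta>)"]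
    by (simp add: mult.assoc nn_integral_cmult)
  also have "\<dots> = ennreal (2 powr real_of_int l) * S"
    unfolding S_def
  proof (subst nn_integral_cmult[symmetric], simp, intro nn_integral_cong)
    fix k :: int
    have "ennreal (2 powr real_of_int k) = ennreal (2 powr real_of_int l) * ennreal (2 powr real_of_int (k - l))"
      by (simp add: ennreal_mult[symmetric] powr_add[symmetric])
    thus "indicator {l..} k * ennreal (2 powr real_of_int k) * m k
      = ennreal (2 powr real_of_int l) * (indicator {l..} k * ennreal (2 powr real_of_int (k - l)) * m k)"
      by (simp only: mult_ac)
  qed
  also have "ennreal (5 powr \<delta> / 2 powr real_of_int l) * (ennreal (2 powr real_of_int l) * S) = ennreal (5 powr \<delta>) * S"
    by (simp add: mult.assoc[symmetric] ennreal_mult[symmetric])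
  finally have W: "hausdorff_content \<delta> W \<le> ennreal (5 powr \<delta>) * S" .
  have "exceptional_set \<delta> y r l = F \<union> W" by (simp add: exceptional_set_def F_def W_def)
  hence "hausdorff_content \<delta> (exceptional_set \<delta> y r l) \<le> hausdorff_content \<delta> F + hausdorff_content \<delta> W"
    by (simp add: hausdorff_content_Un_le)
  also have "\<dots> \<le> ennreal (2 powr \<delta>) * S + ennreal (5 powr \<delta>) * S" by (intro add_mono F W)
  also have "\<dots> = ennreal (2 powr \<delta> + 5 powr \<delta>) * S"
    by (simp add: distrib_right)
  finally show ?thesis by (simp add: S_def m_def)
qed

lemma level_sum_le_outside_exceptional_set:
  "\<exists>K::real. 0 < K \<and> (\<forall>(E :: int \<Rightarrow> 'a::euclidean_space set) y r l x s.
     (\<forall>k i. 0 \<le> r k i) \<longrightarrow> (\<forall>k. E k \<subseteq> (\<Union>i. ball (y k i) (r k i))) \<longrightarrow>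
     x \<notin> exceptional_set \<delta> y r l \<longrightarrow> 0 < s \<longrightarrow>
     isum (\<lambda>k. ennreal (2 powr real_of_int k) * hausdorff_content \<delta> (E k \<inter> ball x s))
       \<le> ennreal (K * 2 powr real_of_int l * s powr \<delta>))"
proof -
  obtain K0 :: real where K0: "0 < K0"
    "\<And>i::int. isum (\<lambda>j. ennreal (2 powr (- 1 * real_of_int \<bar>j - i\<bar>))) \<le> ennreal K0"
    by (rule two_sided_geometric_sum_bound[of 1]) auto
  show ?thesis
  proof (intro exI[of _ "K0 + 2 powr \<delta>"] conjI allI impI)
    show "0 < K0 + 2 powr \<delta>" using K0 by (simp add: add_pos_pos)
    fix E :: "int \<Rightarrow> 'a set" and y :: "int \<Rightarrow> nat \<Rightarrow> 'a" and r :: "int \<Rightarrow> nat \<Rightarrow> real"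
      and l :: int and x :: 'a and s :: real
    assume r: "\<forall>k i. 0 \<le> r k i" and E: "\<forall>k. E k \<subseteq> (\<Union>i. ball (y k i) (r k i))"
      and x: "x \<notin> exceptional_set \<delta> y r l" and "0 < s"
    define \<nu> where "\<nu> = (\<lambda>k. indicator {l..} k * ennreal (2 powr real_of_int k) *
          isum (\<lambda>i. ennreal (r k i powr \<delta>) * indicator (ball x (2 * s)) (y k i)))"
    have "\<not> ennreal (2 powr real_of_int l * (2 * s) powr \<delta>) < isum \<nu>"
      using x \<open>0 < s\<close> unfolding exceptional_set_def \<nu>_def by auto
    hence \<nu>: "isum \<nu> \<le> ennreal (2 powr real_of_int l * (2 * s) powr \<delta>)" by simp
    have "isum (\<lambda>k. ennreal (2 powr real_of_int k) * hausdorff_content \<delta> (E k \<inter> ball x s))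
      \<le> isum (\<lambda>k. ennreal (2 powr real_of_int l * s powr \<delta>) * ennreal (2 powr (- 1 * real_of_int \<bar>k - l\<bar>)) + \<nu> k)"
    proof (rule isum_mono)
      fix k :: int
      show "ennreal (2 powr real_of_int k) * hausdorff_content \<delta> (E k \<inter> ball x s)
        \<le> ennreal (2 powr real_of_int l * s powr \<delta>) * ennreal (2 powr (- 1 * real_of_int \<bar>k - l\<bar>)) + \<nu> k"
      proof (cases "l \<le> k")
        case True
        have "x \<notin> (\<Union>i. ball (y k i) (2 * r k i))"
          using x True unfolding exceptional_set_def by blast
        hence "hausdorff_content \<delta> (E k \<inter> ball x s)
          \<le> isum (\<lambda>i. ennreal (r k i powr \<delta>) * indicator (ball x (2 * s)) (y k i))"
          by (intro hausdorff_content_Int_ball_le_centers) (use r E in auto)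
        hence "ennreal (2 powr real_of_int k) * hausdorff_content \<delta> (E k \<inter> ball x s) \<le> \<nu> k"
          using True by (simp add: \<nu>_def mult_left_mono)
        thus ?thesis by (rule order_trans) simp
      next
        case False
        have "hausdorff_content \<delta> (E k \<inter> ball x s) \<le> hausdorff_content \<delta> (ball x s)"
          by (rule hausdorff_content_mono) auto
        also have "\<dots> \<le> ennreal (s powr \<delta>)" using \<open>0 < s\<close> by (intro hausdorff_content_ball_le) auto
        finally have "ennreal (2 powr real_of_int k) * hausdorff_content \<delta> (E k \<inter> ball x s)
          \<le> ennreal (2 powr real_of_int k) * ennreal (s powr \<delta>)" by (intro mult_left_mono) auto
        also have "\<dots> = ennreal (2 powr real_of_int l * s powr \<delta>) * ennreal (2 powr (- 1 * real_of_int \<bar>k - l\<bar>))"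
        proof -
          have "2 powr real_of_int k = 2 powr real_of_int l * 2 powr (- 1 * real_of_int \<bar>k - l\<bar>)"
            using False unfolding powr_add[symmetric] by simp
          thus ?thesis by (simp only: ennreal_mult[symmetric] powr_ge_zero mult_nonneg_nonneg mult_ac)
        qed
        finally show ?thesis by (rule order_trans) simp
      qed
    qed
    also have "\<dots> = ennreal (2 powr real_of_int l * s powr \<delta>)
        * isum (\<lambda>k. ennreal (2 powr (- 1 * real_of_int \<bar>k - l\<bar>))) + isum \<nu>"
      by (simp add: nn_integral_add nn_integral_cmult)
    also have "\<dots> \<le> ennreal (2 powr real_of_int l * s powr \<delta>) * ennreal K0
        + ennreal (2 powr real_of_int l * (2 * s) powr \<delta>)"
      by (intro add_mono mult_left_mono K0 \<nu>) auto
    also have "\<dots> = ennreal ((K0 + 2 powr \<delta>) * 2 powr real_of_int l * s powr \<delta>)"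
      using K0 \<open>0 < s\<close>
      by (simp add: ennreal_mult[symmetric] ennreal_plus[symmetric] powr_mult algebra_simps del: ennreal_plus)
    finally show "isum (\<lambda>k. ennreal (2 powr real_of_int k) * hausdorff_content \<delta> (E k \<inter> ball x s))
       \<le> ennreal ((K0 + 2 powr \<delta>) * 2 powr real_of_int l * s powr \<delta>)" .
  qed
qed

text \<open>The terms with small \<open>k\<close> are bounded through the content of the ball, those with large
  \<open>k\<close> through the content of the superlevel set; \<open>p > 1\<close> makes the latter summable.\<close>

lemma level_sum_le_norm:
  assumes "1 < p"
  shows "\<exists>K::real. 0 < K \<and> (\<forall>(E :: int \<Rightarrow> 'a::euclidean_space set) B x s. 0 < B \<longrightarrow> 0 < s \<longrightarrow>
     (\<forall>k. ennreal (2 powr (p * real_of_int k)) * hausdorff_content \<delta> (E k) \<le> ennreal B) \<longrightarrow>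
     isum (\<lambda>k. ennreal (2 powr real_of_int k) * hausdorff_content \<delta> (E k \<inter> ball x s))
       \<le> ennreal (K * (B powr (1 / p) * s powr (\<delta> - \<delta> / p))))"
proof -
  obtain K :: real where K: "0 < K" "\<forall>u v. 0 < u \<longrightarrow> 0 < v \<longrightarrow>
      isum (\<lambda>j::int. ennreal (min (u * 2 powr (1 * real_of_int j)) (v * 2 powr (- (p - 1) * real_of_int j))))
        \<le> ennreal (K * (u powr ((p - 1) / (1 + (p - 1))) * v powr (1 / (1 + (p - 1)))))"
    using isum_min_geometric_le[of 1 "p - 1"] assms by auto
  show ?thesis
  proof (intro exI[of _ K] conjI allI impI K(1))
    fix E :: "int \<Rightarrow> 'a set" and B s :: real and x :: 'a
    assume "0 < B" "0 < s"
      and B: "\<forall>k. ennreal (2 powr (p * real_of_int k)) * hausdorff_content \<delta> (E k) \<le> ennreal B"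
    have "isum (\<lambda>k. ennreal (2 powr real_of_int k) * hausdorff_content \<delta> (E k \<inter> ball x s))
      \<le> isum (\<lambda>k. ennreal (min (s powr \<delta> * 2 powr (1 * real_of_int k)) (B * 2 powr (- (p - 1) * real_of_int k))))"
    proof (rule isum_mono)
      fix k :: int
      have "hausdorff_content \<delta> (E k \<inter> ball x s) \<le> hausdorff_content \<delta> (ball x s)"
        by (rule hausdorff_content_mono) auto
      also have "\<dots> \<le> ennreal (s powr \<delta>)" using \<open>0 < s\<close> by (intro hausdorff_content_ball_le) auto
      finally have "ennreal (2 powr real_of_int k) * hausdorff_content \<delta> (E k \<inter> ball x s)
          \<le> ennreal (2 powr real_of_int k) * ennreal (s powr \<delta>)" by (intro mult_left_mono) auto
      also have "\<dots> = ennreal (s powr \<delta> * 2 powr (1 * real_of_int k))"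
        by (simp add: ennreal_mult[symmetric] mult.commute)
      finally have 1: "ennreal (2 powr real_of_int k) * hausdorff_content \<delta> (E k \<inter> ball x s)
          \<le> ennreal (s powr \<delta> * 2 powr (1 * real_of_int k))" .
      have split: "2 powr real_of_int k = 2 powr (- (p - 1) * real_of_int k) * 2 powr (p * real_of_int k)"
        unfolding powr_add[symmetric] by (simp add: algebra_simps)
      have "ennreal (2 powr real_of_int k) * hausdorff_content \<delta> (E k \<inter> ball x s)
          \<le> ennreal (2 powr real_of_int k) * hausdorff_content \<delta> (E k)"
        by (intro mult_left_mono hausdorff_content_mono) auto
      also have "\<dots> = ennreal (2 powr (- (p - 1) * real_of_int k))
          * (ennreal (2 powr (p * real_of_int k)) * hausdorff_content \<delta> (E k))"
        unfolding split by (simp add: ennreal_mult mult.assoc)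
      also have "\<dots> \<le> ennreal (2 powr (- (p - 1) * real_of_int k)) * ennreal B"
        using B by (intro mult_left_mono) auto
      also have "\<dots> = ennreal (B * 2 powr (- (p - 1) * real_of_int k))"
        using \<open>0 < B\<close> by (simp add: ennreal_mult[symmetric] mult.commute)
      finally have 2: "ennreal (2 powr real_of_int k) * hausdorff_content \<delta> (E k \<inter> ball x s)
          \<le> ennreal (B * 2 powr (- (p - 1) * real_of_int k))" .
      show "ennreal (2 powr real_of_int k) * hausdorff_content \<delta> (E k \<inter> ball x s)
        \<le> ennreal (min (s powr \<delta> * 2 powr (1 * real_of_int k)) (B * 2 powr (- (p - 1) * real_of_int k)))"
        using 1 2 by (simp only: min_def split: if_split) simp
    qed
    also have "\<dots> \<le> ennreal (K * ((s powr \<delta>) powr ((p - 1) / (1 + (p - 1))) * B powr (1 / (1 + (p - 1)))))"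
      using K(2) \<open>0 < B\<close> \<open>0 < s\<close> by simp
    also have "(s powr \<delta>) powr ((p - 1) / (1 + (p - 1))) = s powr (\<delta> - \<delta> / p)"
      using assms by (simp add: powr_powr field_simps)
    finally show "isum (\<lambda>k. ennreal (2 powr real_of_int k) * hausdorff_content \<delta> (E k \<inter> ball x s))
       \<le> ennreal (K * (B powr (1 / p) * s powr (\<delta> - \<delta> / p)))"
      by (simp add: mult.commute)
  qed
qed

text \<open>Hedberg's pointwise inequality: \<open>M\<close> plays the part of the maximal function at
  \<open>x\<close> and \<open>N\<close> that of the \<open>L\<^sup>p\<close> norm. The sum over scales converges at
  both ends as \<open>\<alpha> > 0\<close> and \<open>p\<alpha> < \<delta>\<close>.\<close>

lemma riesz_potential_le_of_level_sums:
  assumes "0 < \<alpha>" "\<alpha> < \<delta>" "1 < p" "p * \<alpha> < \<delta>" "0 < K1" "0 < K2"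
  shows "\<exists>C::real. 0 < C \<and> (\<forall>(f :: 'a::euclidean_space \<Rightarrow> ereal) x N M. 0 < N \<longrightarrow> 0 < M \<longrightarrow>
    (\<forall>s>0. isum (\<lambda>k::int. ennreal (2 powr real_of_int k) *
         hausdorff_content \<delta> ({y. ennreal (2 powr real_of_int k) < e2ennreal \<bar>f y\<bar>} \<inter> ball x s))
       \<le> ennreal (min (K1 * (M * s powr \<delta>)) (K2 * (N * s powr (\<delta> - \<delta> / p))))) \<longrightarrow>
    content_riesz_potential \<delta> \<alpha> f x \<le> ennreal (C * (N powr (\<alpha> * p / \<delta>) * M powr (1 - \<alpha> * p / \<delta>))))"
proof -
  define a where "a = \<delta> / p - \<alpha>"
  have "0 < a" using assms by (simp add: a_def field_simps)
  have ab: "a + \<alpha> = \<delta> / p" by (simp add: a_def)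
  have e1: "\<alpha> / (a + \<alpha>) = \<alpha> * p / \<delta>" unfolding ab by simp
  have e2: "a / (a + \<alpha>) = 1 - \<alpha> * p / \<delta>"
    unfolding ab using assms by (simp add: a_def field_simps)
  define c where "c = 2 * (2 powr (\<delta> - \<alpha>) - 1 :: real)"
  have "0 < c" using assms by (simp add: c_def)
  obtain K :: real where K: "0 < K" "\<forall>u v. 0 < u \<longrightarrow> 0 < v \<longrightarrow>
      isum (\<lambda>j::int. ennreal (min (u * 2 powr (a * real_of_int j)) (v * 2 powr (- \<alpha> * real_of_int j))))
        \<le> ennreal (K * (u powr (\<alpha> / (a + \<alpha>)) * v powr (a / (a + \<alpha>))))"
    using isum_min_geometric_le[of a \<alpha>] \<open>0 < a\<close> assms by auto
  define C where "C = c * K * (K2 powr (\<alpha> * p / \<delta>) * K1 powr (1 - \<alpha> * p / \<delta>))"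
  show ?thesis
  proof (intro exI[of _ C] conjI allI impI)
    show "0 < C" using \<open>0 < c\<close> K(1) assms by (simp add: C_def)
    fix f :: "'a \<Rightarrow> ereal" and x :: 'a and N M :: real
    define S where "S = (\<lambda>s. isum (\<lambda>k::int. ennreal (2 powr real_of_int k) *
         hausdorff_content \<delta> ({y. ennreal (2 powr real_of_int k) < e2ennreal \<bar>f y\<bar>} \<inter> ball x s)))"
    assume NM: "0 < N" "0 < M" and "\<forall>s>0. isum (\<lambda>k::int. ennreal (2 powr real_of_int k) *
         hausdorff_content \<delta> ({y. ennreal (2 powr real_of_int k) < e2ennreal \<bar>f y\<bar>} \<inter> ball x s))
       \<le> ennreal (min (K1 * (M * s powr \<delta>)) (K2 * (N * s powr (\<delta> - \<delta> / p))))"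
    hence S: "S s \<le> ennreal (min (K1 * (M * s powr \<delta>)) (K2 * (N * s powr (\<delta> - \<delta> / p))))" if "0 < s" for s
      using that by (simp only: S_def)
    have "content_riesz_potential \<delta> \<alpha> f x
      \<le> isum (\<lambda>j::int. ennreal (c * 2 powr ((\<delta> - \<alpha>) * real_of_int j)) * S (2 powr - real_of_int j))"
      unfolding c_def S_def by (rule riesz_potential_le_level_sum) (rule assms)
    also have "\<dots> \<le> isum (\<lambda>j::int. ennreal c * ennreal (min ((K2 * N) * 2 powr (a * real_of_int j))
        ((K1 * M) * 2 powr (- \<alpha> * real_of_int j))))"
    proof (rule isum_mono)
      fix j :: int
      define t where "t = 2 powr ((\<delta> - \<alpha>) * real_of_int j)"
      have "0 < t" by (simp add: t_def)
      have t1: "t * (2 powr - real_of_int j) powr \<delta> = 2 powr (- \<alpha> * real_of_int j)"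
        unfolding t_def powr_powr powr_add[symmetric] by (simp add: algebra_simps)
      have t2: "t * (2 powr - real_of_int j) powr (\<delta> - \<delta> / p) = 2 powr (a * real_of_int j)"
        unfolding t_def powr_powr powr_add[symmetric] by (simp add: a_def algebra_simps)
      have "ennreal (c * t) * S (2 powr - real_of_int j) \<le> ennreal (c * t) *
        ennreal (min (K1 * (M * (2 powr - real_of_int j) powr \<delta>))
          (K2 * (N * (2 powr - real_of_int j) powr (\<delta> - \<delta> / p))))"
        by (intro mult_left_mono S) auto
      also have "\<dots> = ennreal c * ennreal (t * min (K1 * (M * (2 powr - real_of_int j) powr \<delta>))
          (K2 * (N * (2 powr - real_of_int j) powr (\<delta> - \<delta> / p))))"
        using \<open>0 < c\<close> \<open>0 < t\<close> NM assms by (simp add: ennreal_mult mult.assoc)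
      also have "t * min (K1 * (M * (2 powr - real_of_int j) powr \<delta>))
          (K2 * (N * (2 powr - real_of_int j) powr (\<delta> - \<delta> / p)))
        = min ((K1 * M) * (t * (2 powr - real_of_int j) powr \<delta>))
          ((K2 * N) * (t * (2 powr - real_of_int j) powr (\<delta> - \<delta> / p)))"
        using \<open>0 < t\<close> by (simp add: min_mult_distrib_left mult_ac)
      also have "\<dots> = min ((K2 * N) * 2 powr (a * real_of_int j)) ((K1 * M) * 2 powr (- \<alpha> * real_of_int j))"
        unfolding t1 t2 by (rule min.commute)
      finally show "ennreal (c * 2 powr ((\<delta> - \<alpha>) * real_of_int j)) * S (2 powr - real_of_int j)
        \<le> ennreal c * ennreal (min ((K2 * N) * 2 powr (a * real_of_int j)) ((K1 * M) * 2 powr (- \<alpha> * real_of_int j)))"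
        by (simp only: t_def)
    qed
    also have "\<dots> = ennreal c * isum (\<lambda>j::int. ennreal (min ((K2 * N) * 2 powr (a * real_of_int j))
        ((K1 * M) * 2 powr (- \<alpha> * real_of_int j))))"
      by (rule nn_integral_cmult) auto
    also have "\<dots> \<le> ennreal c * ennreal (K * ((K2 * N) powr (\<alpha> / (a + \<alpha>)) * (K1 * M) powr (a / (a + \<alpha>))))"
      using K(2) NM assms by (intro mult_left_mono) auto
    also have "\<dots> = ennreal (C * (N powr (\<alpha> * p / \<delta>) * M powr (1 - \<alpha> * p / \<delta>)))"
      unfolding e1 e2 C_def using \<open>0 < c\<close> K(1) NM assms
      by (simp add: ennreal_mult[symmetric] powr_mult mult_ac)
    finally show "content_riesz_potential \<delta> \<alpha> f x
      \<le> ennreal (C * (N powr (\<alpha> * p / \<delta>) * M powr (1 - \<alpha> * p / \<delta>)))" .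
  qed
qed

section \<open>The strong type inequality\<close>

lemma choquet_riesz_potential_bound:
  fixes \<delta> \<alpha> p :: real
  assumes "0 < \<alpha>" "\<alpha> < \<delta>" "1 < p" "p * \<alpha> < \<delta>"
  defines "q \<equiv> \<delta> * p / (\<delta> - p * \<alpha>)"
  shows "\<exists>D::real. 0 < D \<and> (\<forall>(f :: 'a::euclidean_space \<Rightarrow> ereal) A. 0 < A \<longrightarrow>
    choquet_integral \<delta> UNIV (\<lambda>x. ennpowr (e2ennreal \<bar>f x\<bar>) p) \<le> ennreal A \<longrightarrow>
    choquet_integral \<delta> UNIV (\<lambda>x. ennpowr (content_riesz_potential \<delta> \<alpha> f x) q) \<le> ennreal (D * A powr (q / p)))"
proof -
  have "0 < \<delta>" "0 < p" using assms by auto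
  have "0 < q" using assms by (simp add: q_def)
  define \<sigma> where "\<sigma> = 1 - \<alpha> * p / \<delta>"
  have \<sigma>q: "\<sigma> * q = p" using assms by (simp add: q_def \<sigma>_def field_simps)
  have exps: "1 / p * (\<alpha> * p / \<delta>) * q + 1 = q / p"
    using assms by (simp add: q_def field_simps)
  define \<kappa> :: real where "\<kappa> = 1 / (1 - 2 powr (- p)) + 1"
  have "0 < \<kappa>" using \<open>0 < p\<close> by (simp add: \<kappa>_def powr_less_one add_pos_pos)
  obtain K1 :: real where K1: "0 < K1" "\<forall>(E :: int \<Rightarrow> 'a set) y r l x s.
     (\<forall>k i. 0 \<le> r k i) \<longrightarrow> (\<forall>k. E k \<subseteq> (\<Union>i. ball (y k i) (r k i))) \<longrightarrow>
     x \<notin> exceptional_set \<delta> y r l \<longrightarrow> 0 < s \<longrightarrow>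
     isum (\<lambda>k. ennreal (2 powr real_of_int k) * hausdorff_content \<delta> (E k \<inter> ball x s))
       \<le> ennreal (K1 * 2 powr real_of_int l * s powr \<delta>)"
    using level_sum_le_outside_exceptional_set[where 'a = 'a, of \<delta>] by (elim exE conjE)
  obtain K2 :: real where K2: "0 < K2" "\<forall>(E :: int \<Rightarrow> 'a set) B x s. 0 < B \<longrightarrow> 0 < s \<longrightarrow>
     (\<forall>k. ennreal (2 powr (p * real_of_int k)) * hausdorff_content \<delta> (E k) \<le> ennreal B) \<longrightarrow>
     isum (\<lambda>k. ennreal (2 powr real_of_int k) * hausdorff_content \<delta> (E k \<inter> ball x s))
       \<le> ennreal (K2 * (B powr (1 / p) * s powr (\<delta> - \<delta> / p)))"
    using level_sum_le_norm[where 'a = 'a and \<delta> = \<delta>, OF assms(3)] by (elim exE conjE)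
  obtain C :: real where C: "0 < C" "\<forall>(f :: 'a \<Rightarrow> ereal) x N M. 0 < N \<longrightarrow> 0 < M \<longrightarrow>
    (\<forall>s>0. isum (\<lambda>k::int. ennreal (2 powr real_of_int k) *
         hausdorff_content \<delta> ({y. ennreal (2 powr real_of_int k) < e2ennreal \<bar>f y\<bar>} \<inter> ball x s))
       \<le> ennreal (min (K1 * (M * s powr \<delta>)) (K2 * (N * s powr (\<delta> - \<delta> / p))))) \<longrightarrow>
    content_riesz_potential \<delta> \<alpha> f x \<le> ennreal (C * (N powr (\<alpha> * p / \<delta>) * M powr (1 - \<alpha> * p / \<delta>)))"
    using riesz_potential_le_of_level_sums[where 'a = 'a, OF assms(1-4) K1(1) K2(1)] by (elim exE conjE)
  obtain K3 :: real where K3: "0 < K3"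
    "\<And>i::int. isum (\<lambda>j. ennreal (2 powr (- (p - 1) * real_of_int \<bar>j - i\<bar>))) \<le> ennreal K3"
    by (rule two_sided_geometric_sum_bound[of "p - 1"]) (use assms in auto)
  define D0 where "D0 = 2 powr \<delta> + 5 powr \<delta>"
  have "0 < D0" by (simp add: D0_def add_pos_pos)
  define D where "D = (2 powr p - 1) * D0 * K3 * C powr q * \<kappa> powr (q / p)"
  have "0 < 2 powr p - 1" using \<open>0 < p\<close> by simp
  show ?thesis
  proof (intro exI[of _ D] conjI allI impI)
    show "0 < D"
      unfolding D_def using \<open>0 < 2 powr p - 1\<close> \<open>0 < D0\<close> K3(1) C(1) \<open>0 < \<kappa>\<close> by simp
    fix f :: "'a \<Rightarrow> ereal" and A :: real
    assume "0 < A" and A: "choquet_integral \<delta> UNIV (\<lambda>x. ennpowr (e2ennreal \<bar>f x\<bar>) p) \<le> ennreal A"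
    define R where "R = content_riesz_potential \<delta> \<alpha> f"
    define E where "E = (\<lambda>k::int. {y. ennreal (2 powr real_of_int k) < e2ennreal \<bar>f y\<bar>})"
    define B where "B = \<kappa> * A"
    have "0 < B" using \<open>0 < \<kappa>\<close> \<open>0 < A\<close> by (simp add: B_def)
    obtain y :: "int \<Rightarrow> nat \<Rightarrow> 'a" and r :: "int \<Rightarrow> nat \<Rightarrow> real" where r: "\<forall>k i. 0 \<le> r k i"
      and cov: "\<forall>k. E k \<subseteq> (\<Union>i. ball (y k i) (r k i))"
      and B: "isum (\<lambda>k. ennreal (2 powr (p * real_of_int k)) * isum (\<lambda>i. ennreal (r k i powr \<delta>))) \<le> ennreal B"
      using superlevel_sets_cover[OF \<open>0 < p\<close> \<open>0 < A\<close> A]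
      unfolding E_def B_def \<kappa>_def by (elim exE conjE)
    define m where "m = (\<lambda>k. isum (\<lambda>i. ennreal (r k i powr \<delta>)))"
    have EB: "ennreal (2 powr (p * real_of_int k)) * hausdorff_content \<delta> (E k) \<le> ennreal B" for k
    proof -
      have "hausdorff_content \<delta> (E k) \<le> m k"
        unfolding m_def by (rule hausdorff_content_le_cover) (use r cov in auto)
      hence "ennreal (2 powr (p * real_of_int k)) * hausdorff_content \<delta> (E k)
          \<le> ennreal (2 powr (p * real_of_int k)) * m k" by (intro mult_left_mono) auto
      also have "\<dots> \<le> isum (\<lambda>k. ennreal (2 powr (p * real_of_int k)) * m k)"
        by (rule isum_ge_term)
      also have "\<dots> \<le> ennreal B" using B by (simp add: m_def)
      finally show ?thesis .
    qed
    define \<Lambda> where "\<Lambda> = C * (B powr (1 / p)) powr (\<alpha> * p / \<delta>)"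
    have "0 < \<Lambda>" using C(1) \<open>0 < B\<close> by (simp add: \<Lambda>_def)
    have R_le: "R x \<le> ennreal (\<Lambda> * 2 powr (\<sigma> * real_of_int l))" if x: "x \<notin> exceptional_set \<delta> y r l" for x l
    proof -
      have "isum (\<lambda>k. ennreal (2 powr real_of_int k) * hausdorff_content \<delta> (E k \<inter> ball x s))
        \<le> ennreal (min (K1 * (2 powr real_of_int l * s powr \<delta>)) (K2 * (B powr (1 / p) * s powr (\<delta> - \<delta> / p))))"
        if "0 < s" for s
      proof -
        have "isum (\<lambda>k. ennreal (2 powr real_of_int k) * hausdorff_content \<delta> (E k \<inter> ball x s))
          \<le> ennreal (K1 * 2 powr real_of_int l * s powr \<delta>)"
          by (rule K1(2)[rule_format, OF r[rule_format] cov[rule_format] x that])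
        moreover have "isum (\<lambda>k. ennreal (2 powr real_of_int k) * hausdorff_content \<delta> (E k \<inter> ball x s))
          \<le> ennreal (K2 * (B powr (1 / p) * s powr (\<delta> - \<delta> / p)))"
          by (rule K2(2)[rule_format, OF \<open>0 < B\<close> that EB])
        ultimately show ?thesis by (simp only: min_def mult.assoc split: if_split) simp
      qed
      hence "R x \<le> ennreal (C * ((B powr (1 / p)) powr (\<alpha> * p / \<delta>) * (2 powr real_of_int l) powr (1 - \<alpha> * p / \<delta>)))"
        unfolding R_def using \<open>0 < B\<close> by (intro C(2)[rule_format]) (auto simp: E_def)
      thus ?thesis by (simp add: \<Lambda>_def \<sigma>_def powr_powr mult.assoc mult.commute[of "real_of_int l"])
    qed
    define b where "b = \<Lambda> powr q"
    have "0 < b" using \<open>0 < \<Lambda>\<close> by (simp add: b_def)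
    define S where "S = (\<lambda>l. isum (\<lambda>k. indicator {l..} k * ennreal (2 powr real_of_int (k - l)) * m k))"
    define \<phi> where "\<phi> = (\<lambda>t. hausdorff_content \<delta> {x. ennreal t < ennpowr (R x) q})"
    have \<phi>_le: "\<phi> (b * (2 powr p) powr real_of_int l) \<le> ennreal D0 * S l" for l
    proof -
      have "b * (2 powr p) powr real_of_int l = (\<Lambda> * 2 powr (\<sigma> * real_of_int l)) powr q"
        using \<open>0 < \<Lambda>\<close> by (simp add: b_def powr_mult powr_powr \<sigma>q[symmetric] mult_ac)
      hence "\<phi> (b * (2 powr p) powr real_of_int l)
          = hausdorff_content \<delta> {x. ennreal (\<Lambda> * 2 powr (\<sigma> * real_of_int l)) < R x}"
        unfolding \<phi>_def using \<open>0 < \<Lambda>\<close> \<open>0 < q\<close>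
          less_ennpowr_iff[of "\<Lambda> * 2 powr (\<sigma> * real_of_int l)" q] by simp
      also have "\<dots> \<le> hausdorff_content \<delta> (exceptional_set \<delta> y r l)"
        using R_le[of _ l] by (intro hausdorff_content_mono) (auto simp: not_le[symmetric])
      also have "\<dots> \<le> ennreal D0 * S l"
        unfolding D0_def S_def m_def
        by (rule hausdorff_content_exceptional_set_le[OF \<open>0 < \<delta>\<close> r[rule_format]])
      finally show ?thesis .
    qed
    have "choquet_integral \<delta> UNIV (\<lambda>x. ennpowr (R x) q) = (\<integral>\<^sup>+t\<in>{0<..}. \<phi> t \<partial>lborel)"
      by (simp add: choquet_integral_def \<phi>_def)
    \<comment> \<open>points of the partition are the powers \<open>q\<close> of the bounds for the potential off the exceptional sets, as \<open>\<sigma> q = p\<close>\<close>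
    also have "\<dots> \<le> isum (\<lambda>_::unit. isum (\<lambda>l::int. ennreal ((2 powr p - 1) * b * (2 powr p) powr real_of_int l)
        * \<phi> (b * (2 powr p) powr real_of_int l)))"
    proof (rule nn_integral_halfline_le_isum)
      show "\<phi> t \<le> isum (\<lambda>_::unit. \<phi> t)" for t using isum_ge_term[of "\<lambda>_::unit. \<phi> t" "()"] .
      show "\<phi> t \<le> \<phi> s" if "0 < s" "s \<le> t" for s t
        unfolding \<phi>_def
        by (rule hausdorff_content_mono) (use that in \<open>auto intro: le_less_trans ennreal_leI\<close>)
    qed (use \<open>0 < p\<close> \<open>0 < b\<close> in auto)
    also have "\<dots> = isum (\<lambda>l::int. ennreal ((2 powr p - 1) * b * (2 powr p) powr real_of_int l)
        * \<phi> (b * (2 powr p) powr real_of_int l))"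
      by (simp add: nn_integral_count_space_finite UNIV_unit)
    also have "\<dots> \<le> isum (\<lambda>l::int. ennreal ((2 powr p - 1) * b * D0) * (ennreal (2 powr (p * real_of_int l)) * S l))"
    proof (rule isum_mono)
      fix l :: int
      have "ennreal ((2 powr p - 1) * b * (2 powr p) powr real_of_int l) * \<phi> (b * (2 powr p) powr real_of_int l)
        \<le> ennreal ((2 powr p - 1) * b * (2 powr p) powr real_of_int l) * (ennreal D0 * S l)"
        by (intro mult_left_mono \<phi>_le) auto
      also have "\<dots> = ennreal ((2 powr p - 1) * b * D0) * (ennreal (2 powr (p * real_of_int l)) * S l)"
      proof -
        have "ennreal ((2 powr p - 1) * b * (2 powr p) powr real_of_int l) * ennreal D0
          = ennreal ((2 powr p - 1) * b * D0) * ennreal (2 powr (p * real_of_int l))"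
          using \<open>0 < 2 powr p - 1\<close> \<open>0 < b\<close> \<open>0 < D0\<close>
          by (simp add: ennreal_mult[symmetric] powr_powr mult_ac)
        thus ?thesis by (simp only: mult.assoc[symmetric])
      qed
      finally show "ennreal ((2 powr p - 1) * b * (2 powr p) powr real_of_int l) * \<phi> (b * (2 powr p) powr real_of_int l)
        \<le> ennreal ((2 powr p - 1) * b * D0) * (ennreal (2 powr (p * real_of_int l)) * S l)" .
    qed
    also have "\<dots> = ennreal ((2 powr p - 1) * b * D0) * isum (\<lambda>l::int. ennreal (2 powr (p * real_of_int l)) * S l)"
      by (rule nn_integral_cmult) auto
    also have "\<dots> \<le> ennreal ((2 powr p - 1) * b * D0) * (ennreal K3 * ennreal B)"
    proof (rule mult_left_mono)
      have "isum (\<lambda>l::int. ennreal (2 powr (p * real_of_int l)) * S l)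
        = isum (\<lambda>l. isum (\<lambda>k. ennreal (2 powr (p * real_of_int l)) *
            (indicator {l..} k * ennreal (2 powr real_of_int (k - l)) * m k)))"
        unfolding S_def by (intro nn_integral_cong nn_integral_cmult[symmetric]) auto
      also have "\<dots> \<le> isum (\<lambda>l. isum (\<lambda>k. ennreal (2 powr (p * real_of_int k)) * m k
            * ennreal (2 powr (- (p - 1) * real_of_int \<bar>l - k\<bar>))))"
      proof (intro isum_mono)
        fix l k :: int
        show "ennreal (2 powr (p * real_of_int l)) * (indicator {l..} k * ennreal (2 powr real_of_int (k - l)) * m k)
          \<le> ennreal (2 powr (p * real_of_int k)) * m k * ennreal (2 powr (- (p - 1) * real_of_int \<bar>l - k\<bar>))"
        proof (cases "l \<le> k")
          case True
          have "2 powr (p * real_of_int l) * 2 powr real_of_int (k - l)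
            = 2 powr (p * real_of_int k) * 2 powr (- (p - 1) * real_of_int \<bar>l - k\<bar>)"
            unfolding powr_add[symmetric] using True by (simp add: algebra_simps)
          hence "ennreal (2 powr (p * real_of_int l)) * ennreal (2 powr real_of_int (k - l))
            = ennreal (2 powr (p * real_of_int k)) * ennreal (2 powr (- (p - 1) * real_of_int \<bar>l - k\<bar>))"
            by (simp only: ennreal_mult[symmetric] powr_ge_zero)
          hence "ennreal (2 powr (p * real_of_int l)) * ennreal (2 powr real_of_int (k - l)) * m k
            = ennreal (2 powr (p * real_of_int k)) * ennreal (2 powr (- (p - 1) * real_of_int \<bar>l - k\<bar>)) * m k"
            by (rule arg_cong)
          moreover have "indicator {l..} k = (1::ennreal)" using True by simp
          ultimately show ?thesis by (simp only: mult_1_left mult_ac order.refl)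
        qed simp
      qed
      also have "\<dots> = isum (\<lambda>k. isum (\<lambda>l. ennreal (2 powr (p * real_of_int k)) * m k
            * ennreal (2 powr (- (p - 1) * real_of_int \<bar>l - k\<bar>))))"
        by (rule isum_swap)
      also have "\<dots> = isum (\<lambda>k. ennreal (2 powr (p * real_of_int k)) * m k
            * isum (\<lambda>l. ennreal (2 powr (- (p - 1) * real_of_int \<bar>l - k\<bar>))))"
        by (intro nn_integral_cong nn_integral_cmult) auto
      also have "\<dots> \<le> isum (\<lambda>k. ennreal (2 powr (p * real_of_int k)) * m k * ennreal K3)"
        by (intro isum_mono mult_left_mono K3) auto
      also have "\<dots> = isum (\<lambda>k. ennreal (2 powr (p * real_of_int k)) * m k) * ennreal K3"
        by (rule nn_integral_multc) auto
      also have "\<dots> \<le> ennreal B * ennreal K3"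
        using B by (intro mult_right_mono) (auto simp: m_def)
      finally show "isum (\<lambda>l::int. ennreal (2 powr (p * real_of_int l)) * S l) \<le> ennreal K3 * ennreal B"
        by (simp only: mult.commute)
    qed simp
    also have "\<dots> = ennreal ((2 powr p - 1) * D0 * K3 * (b * B))"
      using \<open>0 < 2 powr p - 1\<close> \<open>0 < b\<close> \<open>0 < D0\<close> K3(1) \<open>0 < B\<close>
      by (simp add: ennreal_mult[symmetric] mult_ac)
    also have "b * B = C powr q * B powr (q / p)"
    proof -
      have "b * B = C powr q * (B powr (1 / p * (\<alpha> * p / \<delta>) * q) * B powr 1)"
        using C(1) \<open>0 < B\<close> by (simp add: b_def \<Lambda>_def powr_mult powr_powr mult.assoc)
      thus ?thesis by (simp only: powr_add[symmetric] exps)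
    qed
    also have "B powr (q / p) = \<kappa> powr (q / p) * A powr (q / p)"
      using \<open>0 < \<kappa>\<close> \<open>0 < A\<close> by (simp add: B_def powr_mult)
    also have "(2 powr p - 1) * D0 * K3 * (C powr q * (\<kappa> powr (q / p) * A powr (q / p))) = D * A powr (q / p)"
      by (simp only: D_def mult.assoc)
    finally show "choquet_integral \<delta> UNIV (\<lambda>x. ennpowr (content_riesz_potential \<delta> \<alpha> f x) q)
      \<le> ennreal (D * A powr (q / p))" by (simp only: R_def)
  qed
qed

theorem theorem5p11:
  fixes \<delta> \<alpha> p :: real
  assumes "0 < \<delta>" and "\<delta> < real CARD('n::finite)"
    and "0 < \<alpha>" and "\<alpha> < \<delta>"
    and "1 < p" and "p < \<delta> / \<alpha>"
  shows "\<exists>c::real. c > 0 \<and>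
    (\<forall>f :: real ^ 'n \<Rightarrow> ereal. f \<in> borel_measurable lebesgue \<longrightarrow>
      ennpowr
        (choquet_integral \<delta> UNIV
          (\<lambda>x. ennpowr (content_riesz_potential \<delta> \<alpha> f x) (\<delta> * p / (\<delta> - p * \<alpha>))))
        ((\<delta> - p * \<alpha>) / (\<delta> * p))
      \<le> ennreal c *
        ennpowr (choquet_integral \<delta> UNIV (\<lambda>x. ennpowr (e2ennreal \<bar>f x\<bar>) p)) (1 / p))"
proof -
  have "p * \<alpha> < \<delta>" using assms by (simp add: field_simps)
  define q where "q = \<delta> * p / (\<delta> - p * \<alpha>)"
  have "0 < q" "0 < p" using assms \<open>p * \<alpha> < \<delta>\<close> by (simp_all add: q_def)
  have inv_q: "(\<delta> - p * \<alpha>) / (\<delta> * p) = 1 / q" by (simp add: q_def)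
  obtain D :: real where D: "0 < D" "\<forall>(f :: real ^ 'n \<Rightarrow> ereal) A. 0 < A \<longrightarrow>
    choquet_integral \<delta> UNIV (\<lambda>x. ennpowr (e2ennreal \<bar>f x\<bar>) p) \<le> ennreal A \<longrightarrow>
    choquet_integral \<delta> UNIV (\<lambda>x. ennpowr (content_riesz_potential \<delta> \<alpha> f x) q) \<le> ennreal (D * A powr (q / p))"
    using choquet_riesz_potential_bound[where 'a = "real ^ 'n", OF assms(3-5) \<open>p * \<alpha> < \<delta>\<close>]
    unfolding q_def by (elim exE conjE)
  define c where "c = D powr (1 / q)"
  have "0 < c" using D(1) by (simp add: c_def)
  show ?thesis unfolding inv_q q_def[symmetric]
  proof (intro exI[of _ c] conjI allI impI \<open>0 < c\<close>)
    fix f :: "real ^ 'n \<Rightarrow> ereal"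
    define X where "X = choquet_integral \<delta> UNIV (\<lambda>x. ennpowr (e2ennreal \<bar>f x\<bar>) p)"
    define Y where "Y = choquet_integral \<delta> UNIV (\<lambda>x. ennpowr (content_riesz_potential \<delta> \<alpha> f x) q)"
    have bound: "ennpowr Y (1 / q) \<le> ennreal (c * A powr (1 / p))" if "0 < A" "X \<le> ennreal A" for A
    proof -
      have "Y \<le> ennreal (D * A powr (q / p))"
        unfolding Y_def by (rule D(2)[rule_format, OF that(1)]) (use that(2) in \<open>simp add: X_def\<close>)
      hence "ennpowr Y (1 / q) \<le> ennreal ((D * A powr (q / p)) powr (1 / q))"
        using \<open>0 < q\<close> D(1) by (intro ennpowr_le) auto
      also have "(D * A powr (q / p)) powr (1 / q) = c * A powr (1 / p)"
        using \<open>0 < q\<close> D(1) by (simp add: c_def powr_mult powr_powr)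
      finally show ?thesis .
    qed
    have "ennpowr Y (1 / q) \<le> ennreal c * ennpowr X (1 / p)"
    proof (cases X)
      case top
      thus ?thesis using \<open>0 < c\<close> by (simp add: ennpowr_def ennreal_mult_top)
    next
      case (real a)
      show ?thesis
      proof (cases "a = 0")
        case False
        hence "ennpowr Y (1 / q) \<le> ennreal (c * a powr (1 / p))" using real by (intro bound) auto
        thus ?thesis using real \<open>0 < c\<close> by (simp add: ennpowr_def ennreal_mult)
      next
        case True
        \<comment> \<open>\<open>A\<close> must be positive in the estimate, so a vanishing right-hand side is reached as a limit\<close>
        have "ennpowr Y (1 / q) \<le> 0"
        proof (rule ennreal_le_epsilon)
          fix e :: real assume "0 < e"
          define A where "A = (e / c) powr p"
          have "0 < A" using \<open>0 < e\<close> \<open>0 < c\<close> by (simp add: A_def)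
          have "c * A powr (1 / p) = e"
            using \<open>0 < e\<close> \<open>0 < c\<close> \<open>0 < p\<close> by (simp add: A_def powr_powr)
          thus "ennpowr Y (1 / q) \<le> 0 + ennreal e"
            using bound[OF \<open>0 < A\<close>] real True by simp
        qed
        thus ?thesis by (rule order_trans) simp
      qed
    qed
    thus "ennpowr (choquet_integral \<delta> UNIV (\<lambda>x. ennpowr (content_riesz_potential \<delta> \<alpha> f x) q)) (1 / q)
      \<le> ennreal c * ennpowr (choquet_integral \<delta> UNIV (\<lambda>x. ennpowr (e2ennreal \<bar>f x\<bar>) p)) (1 / p)"
      by (simp add: X_def Y_def)
  qed
qed

end
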